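(* Let $n\ge1$ and fix a monomial order on the monomials in $X_1,\dots,X_n$. For any bounded convex set $P\subseteq\mathbb R^n$ of positive volume: a) $S_P$ is convex. b) $S_P$ is compact. c) $\operatorname{vol}(S_P)=\operatorname{vol}(P)$. d) $S_{d\cdot P}=d\cdot S_P$ for all real numbers $d>0$. e) $S_{P+v}=S_P$ for all $v\in\mathbb R^n$.
   Context: $\mathbb N$ is the set of nonnegative integers. A monomial order is a total well-order on the monomials $X^e=X_1^{e_1}\cdots X_n^{e_n}$ ($e\in\mathbb N^n$) compatible with multiplication; the leading monomial of a nonzero polynomial is its largest monomial. For a real number $d$ and $A\subseteq\mathbb R^n$, $d\cdot A=\{da\mid a\in A\}$. For finite $A\subseteq\mathbb R^n$, let $E_A$ be the set of $e\in\mathbb N^n$ such that $X^e$ is not the leading monomial of any nonzero polynomial in $\mathbb R[X_1,\dots,X_n]$ vanishing on $A$. For a bounded convex set $P\subseteq\mathbb R^n$, the sets $2^{-k}\cdot E_{2^k\cdot P\cap\mathbb Z^n}$ ($k\ge0$) form an ascending chain, and \[ S_P=\overline{\bigcup_{k\ge0}2^{-k}\cdot E_{2^k\cdot P\cap\mathbb Z^n}}\subseteq\mathbb R_{\ge0}^n \] is the closure of their union. $\operatorname{vol}$ is $n$-dimensional Lebesgue measure. *)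

theory Defs
  imports "HOL-Analysis.Analysis" "HOL-Library.Poly_Mapping"
begin

text \<open>
  A monomial is identified with its exponent vector in \<open>nat ^ 'n\<close> (with \<open>n = CARD('n)\<close>), so the
  product of monomials is addition of exponent vectors, and a polynomial over the reals in the
  variables indexed by \<open>'n\<close> is a finitely supported map from exponent vectors to coefficients.
\<close>

type_synonym 'n mpoly_real = "(nat ^ 'n) \<Rightarrow>\<^sub>0 real"

text \<open>\<open>(a, b) \<in> r\<close> means that the monomial \<open>a\<close> is smaller than or equal to \<open>b\<close>.\<close>

definition monomial_order :: "((nat ^ 'n) \<times> (nat ^ 'n)) set \<Rightarrow> bool" where
  "monomial_order r \<longleftrightarrow>
     well_order r \<and> (\<forall>a b c. (a, b) \<in> r \<longrightarrow> (a + c, b + c) \<in> r)"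

text \<open>Only meaningful for \<open>p \<noteq> 0\<close>.\<close>

definition leading_monomial ::
    "((nat ^ 'n) \<times> (nat ^ 'n)) set \<Rightarrow> 'n mpoly_real \<Rightarrow> nat ^ 'n" where
  "leading_monomial r p = (THE e. e \<in> Poly_Mapping.keys p \<and> (\<forall>e'\<in>Poly_Mapping.keys p. (e', e) \<in> r))"

definition eval_poly :: "('n::finite) mpoly_real \<Rightarrow> real ^ 'n \<Rightarrow> real" where
  "eval_poly p x = (\<Sum>e\<in>Poly_Mapping.keys p. Poly_Mapping.lookup p e * (\<Prod>i\<in>UNIV. (x $ i) ^ (e $ i)))"

definition standard_exponents ::
    "((nat ^ 'n) \<times> (nat ^ 'n)) set \<Rightarrow> (real ^ 'n::finite) set \<Rightarrow> (nat ^ 'n) set" where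
  "standard_exponents r A =
     {e. \<not> (\<exists>p. p \<noteq> 0 \<and> (\<forall>x\<in>A. eval_poly p x = 0) \<and> leading_monomial r p = e)}"

definition integer_points :: "(real ^ 'n) set" where
  "integer_points = {x. \<forall>i. x $ i \<in> \<int>}"

definition real_vec :: "nat ^ 'n \<Rightarrow> real ^ 'n" where
  "real_vec e = (\<chi> i. real (e $ i))"

definition limit_shape ::
    "((nat ^ 'n) \<times> (nat ^ 'n)) set \<Rightarrow> (real ^ 'n::finite) set \<Rightarrow> (real ^ 'n) set" where
  "limit_shape r P =
     closure (\<Union>k::nat. (\<lambda>e. (1 / 2 ^ k) *\<^sub>R real_vec e) `
       standard_exponents r ((\<lambda>x. 2 ^ k *\<^sub>R x) ` P \<inter> integer_points))"

end

theory Submission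
  imports Defs
begin

text \<open>
  For finite \<open>A\<close>, an exponent \<open>e\<close> lies in \<open>E\<^sub>A\<close> iff some linear combination of the evaluations at the
  points of \<open>A\<close> kills all monomials below \<open>X\<^sup>e\<close> but not \<open>X\<^sup>e\<close> itself. Convolving two such functionals
  and expanding \<open>(x + y)\<^sup>g\<close> by the binomial theorem gives \<open>E\<^sub>A + E\<^sub>B \<subseteq> E\<^sub>A\<^sub>+\<^sub>B\<close>, which yields the chain
  property, convexity of the limit shape, and invariance of \<open>E\<^sub>A\<close> under translations.
  The sets \<open>E\<^sub>A\<close> are closed under passing to smaller exponent vectors, \<open>card E\<^sub>A = card A\<close>, and the
  \<open>i\<close>-th coordinates on \<open>E\<^sub>A\<close> are smaller than the number of \<open>i\<close>-th coordinates of points of \<open>A\<close>; hence the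
  limit shape is bounded and counting grid points gives the volume. Finally, a closed subset of full
  measure of a convex body is the whole body, so (d) and (e) only require inclusions up to an
  arbitrarily small shrinking of \<open>P\<close>, where rounding to lattice vectors and dyadic scalars is possible.
\<close>

section \<open>Polynomial functions with prescribed exponents\<close>

definition mon :: "nat ^ 'n \<Rightarrow> real ^ 'n::finite \<Rightarrow> real" where
  "mon e x = (\<Prod>i\<in>UNIV. (x $ i) ^ (e $ i))"

text \<open>Polynomials are handled through the functions they induce, so that products can be
  formed pointwise; \<open>K\<close> records which exponents may occur.\<close>

definition polyfun :: "(nat ^ 'n) set \<Rightarrow> (real ^ 'n::finite \<Rightarrow> real) set" where
  "polyfun K = {f. \<exists>q. Poly_Mapping.keys q \<subseteq> K \<and> f = eval_poly q}"

lemma mon_add: "mon (e + f) x = mon e x * mon f x"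
  by (simp add: mon_def power_add prod.distrib)

lemma mon_0 [simp]: "mon 0 x = 1"
  by (simp add: mon_def)

lemma eval_poly_superset:
  assumes "finite S" "Poly_Mapping.keys p \<subseteq> S"
  shows "eval_poly p x = (\<Sum>e\<in>S. Poly_Mapping.lookup p e * mon e x)"
  unfolding eval_poly_def mon_def
  by (rule sum.mono_neutral_left) (use assms in \<open>auto simp: in_keys_iff\<close>)

lemma eval_poly_mon: "eval_poly p x = (\<Sum>e\<in>Poly_Mapping.keys p. Poly_Mapping.lookup p e * mon e x)"
  by (simp add: eval_poly_superset)

lemma eval_poly_0 [simp]: "eval_poly 0 x = 0"
  by (simp add: eval_poly_def)

lemma eval_poly_single [simp]: "eval_poly (Poly_Mapping.single e c) x = c * mon e x"
  by (subst eval_poly_superset[of "{e}"]) (auto simp: lookup_single)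

lemma eval_poly_add: "eval_poly (p + q) x = eval_poly p x + eval_poly q x"
proof -
  let ?S = "Poly_Mapping.keys p \<union> Poly_Mapping.keys q"
  have "Poly_Mapping.keys (p + q) \<subseteq> ?S"
    by (rule keys_add)
  then show ?thesis
    by (simp add: eval_poly_superset[of ?S] lookup_add sum.distrib distrib_right)
qed

definition scale_poly :: "real \<Rightarrow> 'n mpoly_real \<Rightarrow> 'n mpoly_real" where
  "scale_poly c p = Poly_Mapping.map ((*) c) p"

lemma lookup_scale_poly [simp]: "Poly_Mapping.lookup (scale_poly c p) e = c * Poly_Mapping.lookup p e"
  by (simp add: scale_poly_def Poly_Mapping.map.rep_eq when_def)

lemma keys_scale_poly: "Poly_Mapping.keys (scale_poly c p) \<subseteq> Poly_Mapping.keys p"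
  by (auto simp: in_keys_iff)

lemma eval_scale_poly [simp]: "eval_poly (scale_poly c p) x = c * eval_poly p x"
  by (subst eval_poly_superset[of "Poly_Mapping.keys p"])
     (auto simp: keys_scale_poly eval_poly_mon sum_distrib_left mult.assoc)

lemma eval_poly_sum: "eval_poly (\<Sum>i\<in>I. p i) x = (\<Sum>i\<in>I. eval_poly (p i) x)"
  by (induction I rule: infinite_finite_induct) (auto simp: eval_poly_add)

lemma polyfun_mono: "K \<subseteq> L \<Longrightarrow> f \<in> polyfun K \<Longrightarrow> f \<in> polyfun L"
  unfolding polyfun_def by blast

lemma polyfun_cong: "f \<in> polyfun K \<Longrightarrow> (\<And>x. f x = g x) \<Longrightarrow> g \<in> polyfun K"
  by (metis ext)

lemma polyfun_mon: "e \<in> K \<Longrightarrow> mon e \<in> polyfun K"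
  unfolding polyfun_def
  by (rule CollectI, rule exI[of _ "Poly_Mapping.single e 1"]) auto

lemma polyfun_0: "(\<lambda>x. 0) \<in> polyfun K"
  unfolding polyfun_def by (rule CollectI, rule exI[of _ 0]) auto

lemma polyfun_add:
  assumes "f \<in> polyfun K" "g \<in> polyfun K"
  shows "(\<lambda>x. f x + g x) \<in> polyfun K"
proof -
  obtain p q where "Poly_Mapping.keys p \<subseteq> K" "f = eval_poly p"
    "Poly_Mapping.keys q \<subseteq> K" "g = eval_poly q"
    using assms unfolding polyfun_def by blast
  then show ?thesis
    unfolding polyfun_def using keys_add[of p q]
    by (intro CollectI exI[of _ "p + q"]) (auto simp: eval_poly_add)
qed

lemma polyfun_scale:
  assumes "f \<in> polyfun K"
  shows "(\<lambda>x. c * f x) \<in> polyfun K"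
proof -
  obtain p where "Poly_Mapping.keys p \<subseteq> K" "f = eval_poly p"
    using assms unfolding polyfun_def by blast
  then show ?thesis
    unfolding polyfun_def using keys_scale_poly[of c p]
    by (intro CollectI exI[of _ "scale_poly c p"]) (auto simp: fun_eq_iff)
qed

lemma polyfun_diff:
  assumes "f \<in> polyfun K" "g \<in> polyfun K"
  shows "(\<lambda>x. f x - g x) \<in> polyfun K"
  using polyfun_add[OF assms(1) polyfun_scale[OF assms(2), of "-1"]] by simp

lemma polyfun_sum:
  assumes "\<And>i. i \<in> I \<Longrightarrow> f i \<in> polyfun K"
  shows "(\<lambda>x. \<Sum>i\<in>I. f i x) \<in> polyfun K"
  using assms
  by (induction I rule: infinite_finite_induct) (auto simp: polyfun_0 polyfun_add)

lemma polyfun_linear_comb: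
  assumes "\<And>e. e \<in> Poly_Mapping.keys q \<Longrightarrow> g e \<in> polyfun K"
  shows "(\<lambda>x. \<Sum>e\<in>Poly_Mapping.keys q. Poly_Mapping.lookup q e * g e x) \<in> polyfun K"
  by (intro polyfun_sum polyfun_scale assms)

lemma polyfun_mon_mult:
  assumes "f \<in> polyfun K"
  shows "(\<lambda>x. mon g x * f x) \<in> polyfun ((+) g ` K)"
proof -
  obtain q where q: "Poly_Mapping.keys q \<subseteq> K" "f = eval_poly q"
    using assms unfolding polyfun_def by blast
  have "(\<lambda>x. \<Sum>e\<in>Poly_Mapping.keys q. Poly_Mapping.lookup q e * mon (g + e) x) \<in> polyfun ((+) g ` K)"
    by (rule polyfun_linear_comb) (use q in \<open>auto intro!: polyfun_mon\<close>)
  then show ?thesis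
    by (rule polyfun_cong) (simp add: q eval_poly_mon mon_add sum_distrib_left mult_ac)
qed

lemma polyfun_mult_UNIV:
  assumes "f \<in> polyfun UNIV" "g \<in> polyfun UNIV"
  shows "(\<lambda>x. f x * g x) \<in> polyfun UNIV"
proof -
  obtain q where q: "f = eval_poly q"
    using assms unfolding polyfun_def by blast
  have "(\<lambda>x. \<Sum>e\<in>Poly_Mapping.keys q. Poly_Mapping.lookup q e * (mon e x * g x)) \<in> polyfun UNIV"
    using polyfun_mon_mult[OF assms(2)]
    by (intro polyfun_linear_comb) (metis polyfun_mono subset_UNIV)
  then show ?thesis
    by (rule polyfun_cong) (simp add: q eval_poly_mon sum_distrib_right mult.assoc)
qed

lemma polyfun_const: "(\<lambda>x. c) \<in> polyfun UNIV"
  using polyfun_scale[OF polyfun_mon[of 0 UNIV], of c] by simp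

lemma polyfun_prod_UNIV:
  assumes "\<And>i. i \<in> I \<Longrightarrow> f i \<in> polyfun UNIV"
  shows "(\<lambda>x. \<Prod>i\<in>I. f i x) \<in> polyfun UNIV"
  using assms
  by (induction I rule: infinite_finite_induct) (auto simp: polyfun_const polyfun_mult_UNIV)

lemma mon_axis [simp]: "mon (axis i m) x = x $ i ^ m"
proof -
  have "mon (axis i m) x = (\<Prod>j\<in>UNIV. if j = i then x $ i ^ m else 1)"
    unfolding mon_def by (rule prod.cong) (auto simp: axis_def)
  then show ?thesis
    by simp
qed

lemma polyfun_component: "(\<lambda>x. x $ i) \<in> polyfun UNIV"
  using polyfun_mon[of "axis i 1" UNIV] by (rule polyfun_cong) auto

text \<open>The product over \<open>b\<close> in \<open>A\<close> of the squared Euclidean distances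
  to \<open>b\<close> is a polynomial whose real zeros are exactly the points of
  \<open>A\<close>.\<close>

lemma polyfun_delta:
  assumes "finite A" "a \<notin> A"
  obtains f where "f \<in> polyfun UNIV" "f a \<noteq> 0" "\<And>x. x \<in> A \<Longrightarrow> f x = 0"
proof -
  define f where "f = (\<lambda>x. \<Prod>b\<in>A. \<Sum>i\<in>UNIV. (x $ i - b $ i) * (x $ i - b $ i))"
  have "f \<in> polyfun UNIV"
    unfolding f_def
    by (intro polyfun_prod_UNIV polyfun_sum polyfun_mult_UNIV polyfun_diff
          polyfun_component polyfun_const)
  moreover have "f a \<noteq> 0"
  proof -
    have "(\<Sum>i\<in>UNIV. (a $ i - b $ i) * (a $ i - b $ i)) \<noteq> 0" if "b \<in> A" for b
    proof -
      have "a \<noteq> b" using that assms by blast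
      then show ?thesis
        by (subst sum_nonneg_eq_0_iff) (auto simp: vec_eq_iff)
    qed
    then show ?thesis
      using assms(1) by (simp add: f_def)
  qed
  moreover have "f x = 0" if "x \<in> A" for x
    using that assms(1) by (auto simp: f_def prod_zero_iff intro!: bexI[of _ x])
  ultimately show ?thesis
    using that by blast
qed

section \<open>Standard exponents\<close>

locale monomial_ordering =
  fixes r :: "((nat ^ 'n::finite) \<times> (nat ^ 'n)) set"
  assumes mo: "monomial_order r"
begin

definition below :: "nat ^ 'n \<Rightarrow> (nat ^ 'n) set" where
  "below e = {f. (f, e) \<in> r \<and> f \<noteq> e}"

definition below_eq :: "nat ^ 'n \<Rightarrow> (nat ^ 'n) set" where
  "below_eq e = {f. (f, e) \<in> r}"

abbreviation std :: "(real ^ 'n) set \<Rightarrow> (nat ^ 'n) set" where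
  "std \<equiv> standard_exponents r"

section \<open>Comparison of exponents and leading exponents\<close>

lemma ord_linear: "linear_order_on UNIV r" and ord_wf: "wf (r - Id)"
proof -
  have "well_order_on UNIV r"
    using mo unfolding monomial_order_def by (metis well_order_on_Field)
  then show "linear_order_on UNIV r" "wf (r - Id)"
    by (simp_all add: well_order_on_def)
qed

lemma ord_refl [simp]: "(e, e) \<in> r"
  using ord_linear by (simp add: order_on_defs refl_on_def)

lemma ord_trans: "(e, f) \<in> r \<Longrightarrow> (f, g) \<in> r \<Longrightarrow> (e, g) \<in> r"
  using ord_linear unfolding order_on_defs by (meson transD)

lemma ord_antisym: "(e, f) \<in> r \<Longrightarrow> (f, e) \<in> r \<Longrightarrow> e = f"
  using ord_linear unfolding order_on_defs by (meson antisymD)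

lemma ord_total: "(e, f) \<in> r \<or> (f, e) \<in> r"
  using ord_linear unfolding order_on_defs total_on_def by (metis UNIV_I ord_refl)

lemma ord_add: "(e, f) \<in> r \<Longrightarrow> (e + g, f + g) \<in> r"
  using mo unfolding monomial_order_def by blast

lemma below_subset_below_eq: "below e \<subseteq> below_eq e"
  by (auto simp: below_def below_eq_def)

lemma below_eq_below_trans: "f \<in> below_eq e \<Longrightarrow> e \<in> below g \<Longrightarrow> f \<in> below g"
  unfolding below_def below_eq_def using ord_trans ord_antisym by blast

lemma not_below: "f \<notin> below e \<longleftrightarrow> (e, f) \<in> r"
  unfolding below_def using ord_total[of e f] ord_antisym[of e f] by auto

lemma below_add: "f \<in> below e \<Longrightarrow> f + g \<in> below (e + g)"
  using ord_add[of f e g] by (simp add: below_def)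

lemma below_induct [case_names less]:
  assumes "\<And>e. (\<And>f. f \<in> below e \<Longrightarrow> Q f) \<Longrightarrow> Q e"
  shows "Q e"
  using ord_wf by (induction e rule: wf_induct_rule) (use assms in \<open>auto simp: below_def\<close>)

lemma ex_least:
  assumes "e \<in> S"
  obtains m where "m \<in> S" "\<And>f. f \<in> S \<Longrightarrow> (m, f) \<in> r"
proof -
  obtain m where m: "m \<in> S" "\<And>f. (f, m) \<in> r - Id \<Longrightarrow> f \<notin> S"
    using wfE_min[OF ord_wf assms] by blast
  have "(m, f) \<in> r" if "f \<in> S" for f
    using m(2)[of f] that ord_total[of m f] by auto
  then show ?thesis using that m(1) by blast
qed

lemma ex_greatest:
  assumes "finite S" "S \<noteq> {}"
  obtains m where "m \<in> S" "S \<subseteq> below_eq m"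
proof -
  have "\<exists>m\<in>S. S \<subseteq> below_eq m"
    using assms
  proof (induction S rule: finite_ne_induct)
    case (singleton x)
    then show ?case by (auto simp: below_eq_def)
  next
    case (insert x F)
    then obtain m where m: "m \<in> F" "F \<subseteq> below_eq m" by blast
    show ?case
    proof (cases "(x, m) \<in> r")
      case True
      then show ?thesis using m by (auto simp: below_eq_def)
    next
      case False
      then have "(m, x) \<in> r" using ord_total by blast
      then have "insert x F \<subseteq> below_eq x"
        using m by (auto simp: below_eq_def intro: ord_trans)
      then show ?thesis by blast
    qed
  qed
  then show ?thesis using that by blast
qed

text \<open>If \<open>a\<close> were smaller than \<open>0\<close>, its multiples would form an infinite descending chain.\<close>

lemma zero_least: "(0, a) \<in> r"
proof (rule ccontr)
  assume neg: "(0, a) \<notin> r"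
  then have a: "(a, 0) \<in> r" using ord_total by blast
  define mult where "mult k = (\<chi> i. k * a $ i)" for k
  obtain m where m: "m \<in> range mult" "\<And>f. f \<in> range mult \<Longrightarrow> (m, f) \<in> r"
    using ex_least[of "mult 0" "range mult"] by auto
  then obtain k where k: "m = mult k" by blast
  have "mult (Suc k) = a + mult k"
    by (simp add: mult_def vec_eq_iff)
  then have "(mult (Suc k), mult k) \<in> r"
    using ord_add[OF a, of "mult k"] by simp
  then have "a + mult k = mult k"
    using m(2)[of "mult (Suc k)"] k \<open>mult (Suc k) = a + mult k\<close> ord_antisym by (metis rangeI)
  then have "a = 0" by simp
  then show False using neg by simp
qed

lemma polyfun_decompose:
  assumes "f \<in> polyfun (below_eq m)"
  obtains c g where "g \<in> polyfun (below m)" "\<And>x. f x = c * mon m x + g x"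
proof -
  obtain q where q: "Poly_Mapping.keys q \<subseteq> below_eq m" "f = eval_poly q"
    using assms unfolding polyfun_def by blast
  define g where "g x = (\<Sum>e\<in>Poly_Mapping.keys q - {m}. Poly_Mapping.lookup q e * mon e x)" for x
  have "g \<in> polyfun (below m)"
    unfolding g_def using q
    by (intro polyfun_sum polyfun_scale polyfun_mon) (auto simp: below_def below_eq_def)
  moreover have "f x = Poly_Mapping.lookup q m * mon m x + g x" for x
  proof -
    have "f x = (\<Sum>e\<in>insert m (Poly_Mapping.keys q - {m}). Poly_Mapping.lookup q e * mon e x)"
      unfolding q by (rule eval_poly_superset) auto
    also have "\<dots> = Poly_Mapping.lookup q m * mon m x + g x"
      unfolding g_def by (subst sum.insert) auto
    finally show ?thesis .
  qed
  ultimately show ?thesis using that by blast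
qed

lemma polyfun_below_eq:
  assumes "f \<in> polyfun K"
  obtains m where "f \<in> polyfun (below_eq m)" "f = (\<lambda>x. 0) \<or> m \<in> K"
proof -
  obtain q where q: "Poly_Mapping.keys q \<subseteq> K" "f = eval_poly q"
    using assms unfolding polyfun_def by blast
  show ?thesis
  proof (cases "q = 0")
    case True
    then have "f = (\<lambda>x. 0)"
      using q by auto
    \<comment> \<open>The zero polynomial has no leading exponent; \<open>0\<close> is an arbitrary
      placeholder for \<open>m\<close>.\<close>
    then show ?thesis using that[of 0] polyfun_0 by auto
  next
    case False
    then obtain m where m: "m \<in> Poly_Mapping.keys q" "Poly_Mapping.keys q \<subseteq> below_eq m"
      using ex_greatest[of "Poly_Mapping.keys q"] by auto
    then show ?thesis using that[of m] q unfolding polyfun_def by blast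
  qed
qed

text \<open>A nonempty finite support has exactly one greatest element, so the definite description
  in \<open>leading_monomial\<close> denotes it.\<close>

lemma leading_monomial_iff:
  assumes "p \<noteq> 0"
  shows "leading_monomial r p = e \<longleftrightarrow> e \<in> Poly_Mapping.keys p \<and> Poly_Mapping.keys p \<subseteq> below_eq e"
proof -
  obtain m where m: "m \<in> Poly_Mapping.keys p" "Poly_Mapping.keys p \<subseteq> below_eq m"
    using ex_greatest[of "Poly_Mapping.keys p"] assms by auto
  have uniq: "e = m" if "e \<in> Poly_Mapping.keys p" "Poly_Mapping.keys p \<subseteq> below_eq e" for e
    using that m ord_antisym[of e m] unfolding below_eq_def by blast
  have "leading_monomial r p = (THE e. e \<in> Poly_Mapping.keys p \<and> Poly_Mapping.keys p \<subseteq> below_eq e)"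
    unfolding leading_monomial_def below_eq_def by (simp add: subset_iff Ball_def)
  also have "\<dots> = m"
    by (rule the_equality) (simp add: m, rule uniq, simp_all)
  finally show ?thesis using m uniq by metis
qed

section \<open>Standard exponents: reduction, downward closure, cardinality\<close>

text \<open>Dividing a vanishing polynomial by its leading coefficient and moving the other terms
  across rewrites \<open>X^e\<close> on \<open>A\<close> through smaller monomials; conversely, such
  a relation is a vanishing polynomial with leading monomial \<open>X^e\<close>.\<close>

lemma nonstandard_iff:
  "e \<notin> std A \<longleftrightarrow> (\<exists>f\<in>polyfun (below e). \<forall>x\<in>A. mon e x = f x)"
proof
  assume "e \<notin> std A"
  then obtain p where p: "p \<noteq> 0" "\<forall>x\<in>A. eval_poly p x = 0" "leading_monomial r p = e"
    unfolding standard_exponents_def by blast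
  then have k: "e \<in> Poly_Mapping.keys p" "Poly_Mapping.keys p \<subseteq> below_eq e"
    using leading_monomial_iff by auto
  let ?l = "Poly_Mapping.lookup p"
  define f where "f x = (\<Sum>g\<in>Poly_Mapping.keys p - {e}. (- ?l g / ?l e) * mon g x)" for x
  have "f \<in> polyfun (below e)"
    unfolding f_def using k
    by (intro polyfun_sum polyfun_scale polyfun_mon) (auto simp: below_def below_eq_def)
  moreover have "mon e x = f x" if "x \<in> A" for x
  proof -
    have "(\<Sum>g\<in>Poly_Mapping.keys p. ?l g * mon g x) = 0"
      using p(2) that eval_poly_mon by metis
    then have "?l e * mon e x = - (\<Sum>g\<in>Poly_Mapping.keys p - {e}. ?l g * mon g x)"
      using k(1) by (subst (asm) sum.remove[of _ e]) auto
    moreover have "?l e \<noteq> 0" using k(1) by (simp add: in_keys_iff)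
    ultimately have "mon e x = - (\<Sum>g\<in>Poly_Mapping.keys p - {e}. ?l g * mon g x) / ?l e"
      by (simp add: field_simps)
    also have "\<dots> = f x"
      unfolding f_def by (simp add: sum_divide_distrib flip: sum_negf)
    finally show ?thesis .
  qed
  ultimately show "\<exists>f\<in>polyfun (below e). \<forall>x\<in>A. mon e x = f x" by blast
next
  assume "\<exists>f\<in>polyfun (below e). \<forall>x\<in>A. mon e x = f x"
  then obtain q where q: "Poly_Mapping.keys q \<subseteq> below e" "\<forall>x\<in>A. mon e x = eval_poly q x"
    unfolding polyfun_def by blast
  define p where "p = Poly_Mapping.single e 1 + scale_poly (-1) q"
  have "Poly_Mapping.lookup q e = 0"
    using q(1) by (auto simp: below_def in_keys_iff)
  then have l: "Poly_Mapping.lookup p e = 1"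
    by (simp add: p_def lookup_add lookup_single)
  have "Poly_Mapping.keys p \<subseteq> insert e (Poly_Mapping.keys q)"
    unfolding p_def using keys_add[of "Poly_Mapping.single e 1" "scale_poly (-1) q"]
      keys_scale_poly[of "-1" q] by auto
  then have "Poly_Mapping.keys p \<subseteq> below_eq e"
    using q(1) by (auto simp: below_def below_eq_def)
  moreover have "p \<noteq> 0" "e \<in> Poly_Mapping.keys p"
    using l by (auto simp: in_keys_iff)
  ultimately have "leading_monomial r p = e"
    using leading_monomial_iff by blast
  moreover have "\<forall>x\<in>A. eval_poly p x = 0"
    using q(2) by (simp add: p_def eval_poly_add)
  ultimately have "\<exists>p. p \<noteq> 0 \<and> (\<forall>x\<in>A. eval_poly p x = 0) \<and> leading_monomial r p = e"
    using \<open>p \<noteq> 0\<close> by (intro exI[of _ p] conjI)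
  then show "e \<notin> std A"
    by (simp add: standard_exponents_def)
qed

lemma nonstandardI: "f \<in> polyfun (below e) \<Longrightarrow> (\<And>x. x \<in> A \<Longrightarrow> mon e x = f x) \<Longrightarrow> e \<notin> std A"
  unfolding nonstandard_iff by (intro bexI[of _ f] ballI)

lemma nonstandardE:
  assumes "e \<notin> std A"
  obtains f where "f \<in> polyfun (below e)" "\<And>x. x \<in> A \<Longrightarrow> mon e x = f x"
  using assms unfolding nonstandard_iff by blast

lemma std_mono:
  assumes "A \<subseteq> B"
  shows "std A \<subseteq> std B"
proof (rule ccontr)
  assume "\<not> std A \<subseteq> std B"
  then obtain e where e: "e \<in> std A" "e \<notin> std B" by blast
  from e(2) obtain f where "f \<in> polyfun (below e)" "\<And>x. x \<in> B \<Longrightarrow> mon e x = f x"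
    by (rule nonstandardE) blast
  then have "e \<notin> std A"
    using assms by (intro nonstandardI[of f]) auto
  then show False using e by simp
qed

lemma std_empty: "std {} = {}"
  using nonstandardI[OF polyfun_0, of "{}"] by auto

text \<open>Multiplying a relation that reduces \<open>X^f\<close> on \<open>A\<close> by
  \<open>X^(e - f)\<close> gives a relation that reduces \<open>X^e\<close>, because the order is
  compatible with multiplication.\<close>

lemma std_lower:
  assumes "e \<in> std A" "\<And>i. f $ i \<le> e $ i"
  shows "f \<in> std A"
proof (rule ccontr)
  assume "f \<notin> std A"
  then obtain h where h: "h \<in> polyfun (below f)" "\<And>x. x \<in> A \<Longrightarrow> mon f x = h x"
    by (rule nonstandardE) blast
  \<comment> \<open>The subtraction of naturals does not truncate, since \<open>f\<close> is
    componentwise at most \<open>e\<close>.\<close>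
  define g where "g = (\<chi> i. e $ i - f $ i)"
  have e: "e = g + f"
    using assms(2) by (simp add: g_def vec_eq_iff)
  have "(+) g ` below f \<subseteq> below e"
    using below_add[of _ f g] by (auto simp: e add.commute)
  then have "(\<lambda>x. mon g x * h x) \<in> polyfun (below e)"
    by (rule polyfun_mono[OF _ polyfun_mon_mult[OF h(1)]])
  then have "e \<notin> std A"
    by (rule nonstandardI) (simp add: h(2) e mon_add)
  then show False
    using assms(1) by simp
qed

text \<open>The new exponent is the smallest \<open>m\<close> that is the leading exponent of a polynomial
  vanishing on \<open>A\<close> but not at \<open>a\<close>.\<close>

lemma std_insert:
  assumes "finite A" "a \<notin> A"
  obtains m where "m \<notin> std A" "std (insert a A) = insert m (std A)"
proof -
  define M where "M = {m. \<exists>f\<in>polyfun (below_eq m). (\<forall>x\<in>A. f x = 0) \<and> f a \<noteq> 0}"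
  obtain f0 where f0: "f0 \<in> polyfun UNIV" "f0 a \<noteq> 0" "\<And>x. x \<in> A \<Longrightarrow> f0 x = 0"
    using polyfun_delta[OF assms] by blast
  obtain m0 where "f0 \<in> polyfun (below_eq m0)"
    by (rule polyfun_below_eq[OF f0(1)])
  then have "m0 \<in> M"
    unfolding M_def using f0(2,3) by (intro CollectI bexI[of _ f0]) auto
  then obtain m where mM: "m \<in> M" and least: "\<And>f. f \<in> M \<Longrightarrow> (m, f) \<in> r"
    by (rule ex_least) blast
  \<comment> \<open>Minimality of \<open>m\<close>: a polynomial with exponents strictly below
    \<open>m\<close> that vanishes on \<open>A\<close> cannot separate \<open>a\<close> from
    \<open>A\<close>.\<close>
  have small: "f a = 0" if f: "f \<in> polyfun (below m)" "\<forall>x\<in>A. f x = 0" for f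
  proof (rule ccontr)
    assume nz: "f a \<noteq> 0"
    obtain m' where m': "f \<in> polyfun (below_eq m')" "f = (\<lambda>x. 0) \<or> m' \<in> below m"
      by (rule polyfun_below_eq[OF f(1)])
    then have "m' \<in> M"
      unfolding M_def using f(2) nz by (intro CollectI bexI[of _ f]) auto
    then have "m' \<notin> below m" using least not_below by simp
    then show False using m' nz by auto
  qed
  obtain p where p: "p \<in> polyfun (below_eq m)" "\<forall>x\<in>A. p x = 0" "p a \<noteq> 0"
    using mM unfolding M_def by blast
  obtain c g where g: "g \<in> polyfun (below m)" "\<And>x. p x = c * mon m x + g x"
    using polyfun_decompose[OF p(1)] by blast
  have "c \<noteq> 0"
  proof
    assume "c = 0"
    then have "p = g" using g(2) by (intro ext) simp
    then show False using small[OF g(1)] p(2,3) by simp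
  qed
  have "m \<notin> std A"
  proof (rule nonstandardI)
    show "(\<lambda>x. (-1/c) * g x) \<in> polyfun (below m)"
      using g(1) by (rule polyfun_scale)
    show "mon m x = (-1/c) * g x" if "x \<in> A" for x
    proof -
      have "c * mon m x + g x = 0"
        using p(2) that g(2)[of x] by simp
      then show ?thesis
        using \<open>c \<noteq> 0\<close> by (simp add: field_simps)
    qed
  qed
  moreover have "m \<in> std (insert a A)"
  proof (rule ccontr)
    assume "m \<notin> std (insert a A)"
    then obtain q where q: "q \<in> polyfun (below m)" "\<And>x. x \<in> insert a A \<Longrightarrow> mon m x = q x"
      by (rule nonstandardE) blast
    have "(\<lambda>x. c * q x + g x) \<in> polyfun (below m)"
      by (intro polyfun_add polyfun_scale q g)
    moreover have eq: "c * q x + g x = p x" if "x \<in> insert a A" for x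
      using q(2)[OF that] g(2)[of x] by simp
    then have "\<forall>x\<in>A. c * q x + g x = 0"
      using p(2) by simp
    ultimately have "c * q a + g a = 0"
      by (rule small)
    then show False
      using eq[of a] p(3) by simp
  qed
  moreover have "e \<in> insert m (std A)" if e: "e \<in> std (insert a A)" for e
  proof (rule ccontr)
    assume "e \<notin> insert m (std A)"
    then have "e \<noteq> m" "e \<notin> std A" by auto
    from this(2) obtain q where q: "q \<in> polyfun (below e)" "\<And>x. x \<in> A \<Longrightarrow> mon e x = q x"
      by (rule nonstandardE) blast
    define f where "f x = mon e x - q x" for x
    have "f \<in> polyfun (below_eq e)"
      unfolding f_def
      by (intro polyfun_diff polyfun_mon polyfun_mono[OF below_subset_below_eq q(1)]) (simp add: below_eq_def)
    show False
    proof (cases "f a = 0")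
      case True
      then have "e \<notin> std (insert a A)"
        using q by (intro nonstandardI[of q]) (auto simp: f_def)
      then show False
        using e by simp
    next
      case False
      then have "e \<in> M"
        unfolding M_def using \<open>f \<in> polyfun (below_eq e)\<close> q(2)
        by (intro CollectI bexI[of _ f]) (simp_all add: f_def)
      then have "m \<in> below e"
        using least \<open>e \<noteq> m\<close> by (simp add: below_def)
      then have "p \<in> polyfun (below e)"
        using below_eq_below_trans by (intro polyfun_mono[OF _ p(1)]) blast
      \<comment> \<open>The multiple of \<open>p\<close> leaves the values on \<open>A\<close>
        unchanged and corrects the value at \<open>a\<close>.\<close>
      then have "(\<lambda>x. q x + (f a / p a) * p x) \<in> polyfun (below e)"
        by (intro polyfun_add polyfun_scale q)
      moreover have "mon e x = q x + (f a / p a) * p x" if "x \<in> insert a A" for x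
        using that p(2,3) q(2) by (auto simp: f_def)
      ultimately have "e \<notin> std (insert a A)"
        by (rule nonstandardI)
      then show False
        using e by simp
    qed
  qed
  moreover have "std A \<subseteq> std (insert a A)"
    by (rule std_mono) auto
  ultimately have "std (insert a A) = insert m (std A)"
    by blast
  with \<open>m \<notin> std A\<close> show ?thesis
    by (rule that)
qed

text \<open>By \<open>std_insert\<close>, each new point contributes exactly one new
  exponent.\<close>

lemma std_card:
  assumes "finite A"
  shows "finite (std A) \<and> card (std A) = card A"
  using assms
proof induction
  case empty
  then show ?case by (simp add: std_empty)
next
  case (insert a A)
  obtain m where "m \<notin> std A" "std (insert a A) = insert m (std A)"
    using std_insert[OF insert.hyps] by blast
  then show ?case using insert by simp
qed

section \<open>Normal forms and dual functionals\<close>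

text \<open>Well-founded induction: a nonstandard monomial agrees on \<open>A\<close> with a
  combination of smaller ones, which are already reduced. The bound \<open>below_eq e\<close> is
  kept because it later forces the coefficients of larger exponents to vanish.\<close>

lemma mon_normal_form: "\<exists>f\<in>polyfun (std A \<inter> below_eq e). \<forall>x\<in>A. mon e x = f x"
proof (induction e rule: below_induct)
  case (less e)
  show ?case
  proof (cases "e \<in> std A")
    case True
    then show ?thesis
      by (intro bexI[of _ "mon e"] polyfun_mon) (auto simp: below_eq_def)
  next
    case False
    then obtain q where q: "Poly_Mapping.keys q \<subseteq> below e" "\<And>x. x \<in> A \<Longrightarrow> mon e x = eval_poly q x"
      by (rule nonstandardE[of e A, unfolded polyfun_def]) blast
    have "\<forall>g\<in>Poly_Mapping.keys q. \<exists>f\<in>polyfun (std A \<inter> below_eq e). \<forall>x\<in>A. mon g x = f x"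
    proof
      fix g assume "g \<in> Poly_Mapping.keys q"
      then have g: "g \<in> below e" using q by blast
      then have "std A \<inter> below_eq g \<subseteq> std A \<inter> below_eq e"
        unfolding below_def below_eq_def using ord_trans by blast
      then show "\<exists>f\<in>polyfun (std A \<inter> below_eq e). \<forall>x\<in>A. mon g x = f x"
        using less[OF g] polyfun_mono by blast
    qed
    then obtain h where h: "\<And>g. g \<in> Poly_Mapping.keys q \<Longrightarrow> h g \<in> polyfun (std A \<inter> below_eq e)"
      "\<And>g x. g \<in> Poly_Mapping.keys q \<Longrightarrow> x \<in> A \<Longrightarrow> mon g x = h g x"
      by metis
    show ?thesis
      by (rule bexI[OF _ polyfun_linear_comb[of q h, OF h(1)]])
         (use q h(2) in \<open>auto simp: eval_poly_mon\<close>)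
  qed
qed

lemma polyfun_normal_form:
  assumes "f \<in> polyfun UNIV"
  shows "\<exists>g\<in>polyfun (std A). \<forall>x\<in>A. f x = g x"
proof -
  obtain q where q: "f = eval_poly q"
    using assms unfolding polyfun_def by blast
  have "\<forall>e. \<exists>f\<in>polyfun (std A). \<forall>x\<in>A. mon e x = f x"
  proof
    fix e
    obtain f where "f \<in> polyfun (std A \<inter> below_eq e)" "\<forall>x\<in>A. mon e x = f x"
      using mon_normal_form by blast
    then show "\<exists>f\<in>polyfun (std A). \<forall>x\<in>A. mon e x = f x"
      using polyfun_mono[of "std A \<inter> below_eq e" "std A" f] by auto
  qed
  then obtain h where h: "\<And>e. h e \<in> polyfun (std A)" "\<And>e x. x \<in> A \<Longrightarrow> mon e x = h e x"
    by metis
  show ?thesis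
    by (rule bexI[OF _ polyfun_linear_comb[of q h, OF h(1)]])
       (use q h(2) in \<open>auto simp: eval_poly_mon\<close>)
qed

text \<open>The leading monomial of a nonzero polynomial vanishing on \<open>A\<close> is
  nonstandard by definition; hence the standard monomials are linearly independent as functions on
  \<open>A\<close>.\<close>

lemma std_independent:
  assumes "Poly_Mapping.keys p \<subseteq> std A" "\<And>x. x \<in> A \<Longrightarrow> eval_poly p x = 0"
  shows "p = 0"
proof (rule ccontr)
  assume "p \<noteq> 0"
  then have "leading_monomial r p \<in> Poly_Mapping.keys p"
    using leading_monomial_iff by blast
  then have "leading_monomial r p \<in> std A" using assms(1) by blast
  then have "\<not> (p \<noteq> 0 \<and> (\<forall>x\<in>A. eval_poly p x = 0))"
    unfolding standard_exponents_def by auto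
  then show False
    using assms(2) \<open>p \<noteq> 0\<close> by simp
qed

text \<open>The functional reads off the coefficient of \<open>X\<^sup>e\<close> in the normal form modulo the vanishing
  ideal of \<open>A\<close>; its weight at \<open>a\<close> comes from the normal form of the delta function at \<open>a\<close>.\<close>

lemma std_functional:
  assumes "finite A" "e \<in> std A"
  obtains c where "\<And>f. f \<in> below e \<Longrightarrow> (\<Sum>a\<in>A. c a * mon f a) = 0"
    "(\<Sum>a\<in>A. c a * mon e a) = 1"
proof -
  have "\<exists>p. Poly_Mapping.keys p \<subseteq> std A \<and> (\<forall>x\<in>A. eval_poly p x = (if x = a then 1 else 0))"
    if "a \<in> A" for a
  proof -
    obtain f where f: "f \<in> polyfun UNIV" "f a \<noteq> 0" "\<And>x. x \<in> A - {a} \<Longrightarrow> f x = 0"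
      using polyfun_delta[of "A - {a}" a] assms(1) by auto
    have "(\<lambda>x. (1 / f a) * f x) \<in> polyfun UNIV"
      by (rule polyfun_scale[OF f(1)])
    then obtain g where "g \<in> polyfun (std A)" "\<forall>x\<in>A. (1 / f a) * f x = g x"
      using polyfun_normal_form by blast
    then show ?thesis
      using f(2,3) unfolding polyfun_def by force
  qed
  then obtain d where d: "\<And>a. a \<in> A \<Longrightarrow> Poly_Mapping.keys (d a) \<subseteq> std A"
    "\<And>a x. a \<in> A \<Longrightarrow> x \<in> A \<Longrightarrow> eval_poly (d a) x = (if x = a then 1 else 0)"
    by metis
  define c where "c a = Poly_Mapping.lookup (d a) e" for a
  have coeff: "(\<Sum>a\<in>A. c a * eval_poly q a) = Poly_Mapping.lookup q e"
    if q: "Poly_Mapping.keys q \<subseteq> std A" for q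
  proof -
    \<comment> \<open>\<open>s\<close> interpolates the values of \<open>q\<close> on
      \<open>A\<close> by the delta functions \<open>d a\<close>; independence of the standard
      monomials then gives \<open>s = q\<close>.\<close>
    define s where "s = (\<Sum>a\<in>A. scale_poly (eval_poly q a) (d a))"
    have "q + scale_poly (-1) s = 0"
    proof (rule std_independent)
      have "Poly_Mapping.keys s \<subseteq> std A"
        unfolding s_def using keys_sum keys_scale_poly d(1) by fastforce
      then show "Poly_Mapping.keys (q + scale_poly (-1) s) \<subseteq> std A"
        using keys_add[of q "scale_poly (-1) s"] keys_scale_poly[of "-1" s] q by blast
      show "eval_poly (q + scale_poly (-1) s) x = 0" if "x \<in> A" for x
      proof -
        have "eval_poly s x = (\<Sum>a\<in>A. if x = a then eval_poly q a else 0)"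
          unfolding s_def eval_poly_sum using d(2) that by (intro sum.cong) auto
        then show ?thesis
          using that assms(1) by (simp add: eval_poly_add)
      qed
    qed
    then have "Poly_Mapping.lookup (q + scale_poly (-1) s) e = 0"
      by simp
    then have "Poly_Mapping.lookup q e = Poly_Mapping.lookup s e"
      by (simp add: lookup_add)
    also have "\<dots> = (\<Sum>a\<in>A. eval_poly q a * c a)"
      by (simp add: s_def lookup_sum c_def)
    finally show ?thesis by (simp only: mult.commute[of "c _"])
  qed
  show ?thesis
  proof
    fix f assume f: "f \<in> below e"
    obtain q where q: "Poly_Mapping.keys q \<subseteq> std A \<inter> below_eq f" "\<forall>x\<in>A. mon f x = eval_poly q x"
      using mon_normal_form[of A f] unfolding polyfun_def by blast
    have "e \<notin> below_eq f"
      using f not_below unfolding below_eq_def by blast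
    then have "Poly_Mapping.lookup q e = 0"
      using q(1) by (auto simp: in_keys_iff)
    then show "(\<Sum>a\<in>A. c a * mon f a) = 0"
      using coeff[of q] q by simp
  next
    show "(\<Sum>a\<in>A. c a * mon e a) = 1"
      using coeff[of "Poly_Mapping.single e 1"] assms(2) by simp
  qed
qed

end

section \<open>Sums of point sets\<close>

text \<open>The binomial theorem is applied in each coordinate, and the product of the resulting
  sums is expanded over all choice functions \<open>u\<close>.\<close>

lemma mon_plus:
  "mon g (x + y) = (\<Sum>u\<in>(\<Pi>\<^sub>E i\<in>UNIV. {..g $ i}). (\<Prod>i\<in>UNIV. real (g $ i choose u i)) *
     mon (\<chi> i. u i) x * mon (\<chi> i. g $ i - u i) y)"
proof -
  have "mon g (x + y) = (\<Prod>i\<in>UNIV. \<Sum>k\<le>g $ i. real (g $ i choose k) * (x $ i) ^ k * (y $ i) ^ (g $ i - k))"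
    by (simp add: mon_def binomial_ring)
  also have "\<dots> = (\<Sum>u\<in>(\<Pi>\<^sub>E i\<in>UNIV. {..g $ i}). \<Prod>i\<in>UNIV.
      real (g $ i choose u i) * (x $ i) ^ u i * (y $ i) ^ (g $ i - u i))"
    by (rule prod_sum_PiE) auto
  also have "\<dots> = (\<Sum>u\<in>(\<Pi>\<^sub>E i\<in>UNIV. {..g $ i}). (\<Prod>i\<in>UNIV. real (g $ i choose u i)) *
     mon (\<chi> i. u i) x * mon (\<chi> i. g $ i - u i) y)"
    by (simp add: mon_def prod.distrib)
  finally show ?thesis .
qed

text \<open>Serves to bound exponents: where the \<open>i\<close>-th coordinate lies in
  \<open>V\<close>, the product vanishes, so \<open>X_i^(card V)\<close> reduces to lower powers of
  the same variable.\<close>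

lemma prod_linear_factors:
  fixes i :: "'n::finite"
  assumes "finite V"
  shows "(\<lambda>x. (\<Prod>v\<in>V. x $ i - v) - mon (axis i (card V)) x) \<in> polyfun {axis i j |j. j < card V}"
  using assms
proof induction
  case empty
  then show ?case by (simp add: polyfun_0)
next
  case (insert v V)
  let ?K = "{axis i j |j. j < Suc (card V)}"
  define g where "g x = (\<Prod>v\<in>V. x $ i - v) - mon (axis i (card V)) x" for x
  have g: "g \<in> polyfun {axis i j |j. j < card V}"
    by (rule polyfun_cong[OF insert.IH]) (simp add: g_def)
  have "(+) (axis i 1) ` {axis i j |j. j < card V} \<subseteq> ?K"
  proof
    fix z :: "nat ^ 'n" assume "z \<in> (+) (axis i 1) ` {axis i j |j. j < card V}"
    then obtain j where j: "j < card V" "z = axis i 1 + axis i j" by blast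
    then have "z = axis i (Suc j)" by (simp add: axis_def vec_eq_iff)
    then show "z \<in> ?K" using j(1) by blast
  qed
  then have 1: "(\<lambda>x. mon (axis i 1) x * g x) \<in> polyfun ?K"
    by (rule polyfun_mono[OF _ polyfun_mon_mult[OF g]])
  have 2: "mon (axis i (card V)) \<in> polyfun ?K"
    by (rule polyfun_mon) auto
  have 3: "g \<in> polyfun ?K"
    by (rule polyfun_mono[OF _ g]) auto
  \<comment> \<open>The product over \<open>V\<close> is \<open>X_i^(card V) + g\<close>;
    multiplying it by \<open>x $ i - v\<close> and removing the new top power leaves these
    terms.\<close>
  have "(\<lambda>x. mon (axis i 1) x * g x - (v * mon (axis i (card V)) x + v * g x)) \<in> polyfun ?K"
    by (intro polyfun_diff polyfun_add polyfun_scale 1 2 3)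
  then have "(\<lambda>x. (\<Prod>v\<in>insert v V. x $ i - v) - mon (axis i (Suc (card V))) x) \<in> polyfun ?K"
    by (rule polyfun_cong) (use insert.hyps in \<open>simp add: g_def algebra_simps\<close>)
  then show ?case
    using insert.hyps by simp
qed

context monomial_ordering
begin

text \<open>In the order, \<open>e + f\<close> is at most \<open>h + f\<close>, which is at most
  \<open>h + k\<close>; the reverse bound collapses this chain, and cancellation applies. In the
  convolution below this singles out one surviving term.\<close>

lemma add_le_eq:
  assumes "(e, h) \<in> r" "(f, k) \<in> r" "(h + k, e + f) \<in> r"
  shows "h = e \<and> k = f"
proof -
  have 1: "(e + f, h + f) \<in> r"
    by (rule ord_add[OF assms(1)])
  have 2: "(h + f, h + k) \<in> r"
    using ord_add[OF assms(2), of h] by (simp add: add.commute)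
  have "h + k = e + f"
    using ord_trans[OF 1 2] assms(3) by (rule ord_antisym[symmetric])
  then have "h + f = e + f"
    using 1 2 ord_antisym[of "e + f" "h + f"] by simp
  then have "h = e" by simp
  then show ?thesis using \<open>h + k = e + f\<close> by simp
qed

text \<open>The convolution of the functionals of \<open>e\<close> and \<open>f\<close> is supported on \<open>A + B\<close>, kills all
  monomials below \<open>X\<^sup>e\<^sup>+\<^sup>f\<close>, and maps \<open>X\<^sup>e\<^sup>+\<^sup>f\<close> to a product of binomial coefficients, which is nonzero.\<close>

lemma std_add:
  assumes "finite A" "finite B" "e \<in> std A" "f \<in> std B"
    and C: "\<And>a b. a \<in> A \<Longrightarrow> b \<in> B \<Longrightarrow> a + b \<in> C"
  shows "e + f \<in> std C"
proof (rule ccontr)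
  assume "e + f \<notin> std C"
  then obtain h where h: "h \<in> polyfun (below (e + f))" "\<And>x. x \<in> C \<Longrightarrow> mon (e + f) x = h x"
    by (rule nonstandardE) blast
  obtain q where q: "Poly_Mapping.keys q \<subseteq> below (e + f)" "h = eval_poly q"
    using h(1) unfolding polyfun_def by blast
  obtain c where c: "\<And>g. g \<in> below e \<Longrightarrow> (\<Sum>a\<in>A. c a * mon g a) = 0" "(\<Sum>a\<in>A. c a * mon e a) = 1"
    using std_functional[OF assms(1,3)] by blast
  obtain d where d: "\<And>g. g \<in> below f \<Longrightarrow> (\<Sum>b\<in>B. d b * mon g b) = 0" "(\<Sum>b\<in>B. d b * mon f b) = 1"
    using std_functional[OF assms(2,4)] by blast
  define L where "L \<phi> = (\<Sum>a\<in>A. \<Sum>b\<in>B. c a * d b * \<phi> (a + b))" for \<phi> :: "real ^ 'n \<Rightarrow> real"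
  define binom where "binom g u = (\<Prod>i\<in>UNIV. real (g $ i choose u i))" for g :: "nat ^ 'n" and u
  define t where "t g u = binom g u * ((\<Sum>a\<in>A. c a * mon (\<chi> i. u i) a) *
     (\<Sum>b\<in>B. d b * mon (\<chi> i. g $ i - u i) b))" for g u
  have L_mon: "L (mon g) = (\<Sum>u\<in>(\<Pi>\<^sub>E i\<in>UNIV. {..g $ i}). t g u)" for g
  proof -
    let ?U = "\<Pi>\<^sub>E i\<in>UNIV. {..g $ i}"
    have "L (mon g) = (\<Sum>a\<in>A. \<Sum>b\<in>B. \<Sum>u\<in>?U. binom g u * (c a * mon (\<chi> i. u i) a) *
        (d b * mon (\<chi> i. g $ i - u i) b))"
      unfolding L_def mon_plus binom_def by (simp add: sum_distrib_left mult_ac)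
    also have "\<dots> = (\<Sum>a\<in>A. \<Sum>u\<in>?U. \<Sum>b\<in>B. binom g u * (c a * mon (\<chi> i. u i) a) *
        (d b * mon (\<chi> i. g $ i - u i) b))"
      by (rule sum.cong[OF refl], rule sum.swap)
    also have "\<dots> = (\<Sum>u\<in>?U. \<Sum>a\<in>A. \<Sum>b\<in>B. binom g u * (c a * mon (\<chi> i. u i) a) *
        (d b * mon (\<chi> i. g $ i - u i) b))"
      by (rule sum.swap)
    also have "\<dots> = (\<Sum>u\<in>?U. t g u)"
      unfolding t_def sum_product by (simp only: sum_distrib_left mult.assoc)
    finally show ?thesis .
  qed
  \<comment> \<open>If both functionals are nonzero on their factors, the two parts of
    \<open>g\<close> are at least \<open>e\<close> and \<open>f\<close>, while their sum
    \<open>g\<close> is at most \<open>e + f\<close>; so equality holds.\<close>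
  have t_zero: "g = e + f \<and> (\<chi> i. u i) = e" if "u \<in> (\<Pi>\<^sub>E i\<in>UNIV. {..g $ i})" "g \<in> below_eq (e + f)" "t g u \<noteq> 0" for g u
  proof -
    have split: "(\<chi> i. u i) + (\<chi> i. g $ i - u i) = g"
      using that(1) by (simp add: vec_eq_iff PiE_iff)
    have "(\<chi> i. u i) \<notin> below e"
      using that(3) c(1) by (force simp: t_def)
    moreover have "(\<chi> i. g $ i - u i) \<notin> below f"
      using that(3) d(1) by (force simp: t_def)
    ultimately have "(e, \<chi> i. u i) \<in> r" "(f, \<chi> i. g $ i - u i) \<in> r"
      by (simp_all add: not_below)
    moreover have "((\<chi> i. u i) + (\<chi> i. g $ i - u i), e + f) \<in> r"
      using that(2) unfolding split by (simp add: below_eq_def)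
    ultimately have "(\<chi> i. u i) = e \<and> (\<chi> i. g $ i - u i) = f"
      by (rule add_le_eq)
    then show ?thesis
      using split by simp
  qed
  have L_below: "L (mon g) = 0" if "g \<in> below (e + f)" for g
    unfolding L_mon
  proof (rule sum.neutral, rule ballI, rule ccontr)
    fix u assume "u \<in> (\<Pi>\<^sub>E i\<in>UNIV. {..g $ i})" "t g u \<noteq> 0"
    then have "g = e + f"
      using t_zero[of u g] that below_subset_below_eq[of "e + f"] by blast
    then show False
      using that by (simp add: below_def)
  qed
  have "L (mon (e + f)) = t (e + f) (($) e)"
  proof -
    have "L (mon (e + f)) = (\<Sum>u\<in>{($) e}. t (e + f) u)"
      unfolding L_mon
    proof (rule sum.mono_neutral_right)
      show "finite (\<Pi>\<^sub>E i\<in>UNIV. {..(e + f) $ i})"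
        by (intro finite_PiE) auto
      show "{($) e} \<subseteq> (\<Pi>\<^sub>E i\<in>UNIV. {..(e + f) $ i})"
        by (auto simp: PiE_iff)
      show "\<forall>u\<in>(\<Pi>\<^sub>E i\<in>UNIV. {..(e + f) $ i}) - {($) e}. t (e + f) u = 0"
      proof (rule ballI, rule ccontr)
        fix u assume u: "u \<in> (\<Pi>\<^sub>E i\<in>UNIV. {..(e + f) $ i}) - {($) e}" "t (e + f) u \<noteq> 0"
        then have "(\<chi> i. u i) = e"
          using t_zero[of u "e + f"] by (simp add: below_eq_def)
        then have "u = ($) e" by auto
        then show False using u by blast
      qed
    qed
    then show ?thesis by simp
  qed
  also have "\<dots> = binom (e + f) (($) e)"
  proof -
    have "(\<chi> i. (e + f) $ i - e $ i) = f" by (simp add: vec_eq_iff)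
    then show ?thesis using c(2) d(2) by (simp add: t_def vec_nth_inverse)
  qed
  also have "\<dots> \<noteq> 0"
    by (simp add: binom_def)
  finally have "L (mon (e + f)) \<noteq> 0" .
  \<comment> \<open>All points \<open>a + b\<close> lie in \<open>C\<close>, where \<open>h\<close>
    agrees with \<open>X^(e + f)\<close>; but every monomial of \<open>h\<close> is killed by
    \<open>L\<close>.\<close>
  moreover have "L (mon (e + f)) = L h"
    unfolding L_def using C h(2) by (intro sum.cong) auto
  moreover have "L h = (\<Sum>g\<in>Poly_Mapping.keys q. Poly_Mapping.lookup q g * L (mon g))"
  proof -
    have "L h = (\<Sum>a\<in>A. \<Sum>b\<in>B. \<Sum>g\<in>Poly_Mapping.keys q. Poly_Mapping.lookup q g * (c a * d b * mon g (a + b)))"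
      unfolding L_def q(2) eval_poly_mon by (simp add: sum_distrib_left mult_ac)
    also have "\<dots> = (\<Sum>a\<in>A. \<Sum>g\<in>Poly_Mapping.keys q. \<Sum>b\<in>B. Poly_Mapping.lookup q g * (c a * d b * mon g (a + b)))"
      by (rule sum.cong[OF refl], rule sum.swap)
    also have "\<dots> = (\<Sum>g\<in>Poly_Mapping.keys q. \<Sum>a\<in>A. \<Sum>b\<in>B. Poly_Mapping.lookup q g * (c a * d b * mon g (a + b)))"
      by (rule sum.swap)
    finally show ?thesis
      unfolding L_def by (simp add: sum_distrib_left)
  qed
  moreover have "\<dots> = 0"
    using q(1) L_below by (intro sum.neutral) auto
  ultimately show False by simp
qed

section \<open>Translation invariance and coordinate bounds for standard exponents\<close>

text \<open>There is exactly one standard exponent, and downward closure forces it to be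
  \<open>0\<close>.\<close>

lemma zero_in_std_singleton: "0 \<in> std {v}"
proof -
  have "card (std {v}) = 1"
    using std_card[of "{v}"] by simp
  then obtain e where "std {v} = {e}"
    using card_1_singletonE by blast
  then show ?thesis
    using std_lower[of e "{v}" 0] by simp
qed

text \<open>Translating by \<open>v\<close> amounts to adding the point set \<open>{v}\<close>,
  which contributes the exponent \<open>0\<close>.\<close>

lemma std_translate_subset:
  assumes "finite A"
  shows "std A \<subseteq> std ((+) v ` A)"
proof
  fix e assume "e \<in> std A"
  then have "e + 0 \<in> std ((+) v ` A)"
    using assms zero_in_std_singleton[of v] by (intro std_add[of A "{v}"]) (auto simp: add.commute)
  then show "e \<in> std ((+) v ` A)" by simp
qed

lemma std_translate:
  assumes "finite A"
  shows "std ((+) v ` A) = std A"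
proof
  have "std ((+) v ` A) \<subseteq> std ((+) (- v) ` (+) v ` A)"
    by (rule std_translate_subset) (use assms in simp)
  also have "(+) (- v) ` (+) v ` A = A"
    by (simp add: image_image)
  finally show "std ((+) v ` A) \<subseteq> std A" .
  show "std A \<subseteq> std ((+) v ` A)"
    by (rule std_translate_subset[OF assms])
qed

lemma axis_below: "j < m \<Longrightarrow> axis i j \<in> below (axis i m)"
proof -
  assume "j < m"
  then have "axis i m = axis i (m - j) + axis i j" "axis i j \<noteq> axis i m"
    by (auto simp: axis_def vec_eq_iff)
  then show ?thesis
    using ord_add[OF zero_least[of "axis i (m - j)"], of "axis i j"] by (simp add: below_def)
qed

text \<open>Otherwise downward closure would make \<open>X_i^(card V)\<close> standard, although the
  monic polynomial in \<open>X_i\<close> with root set \<open>V\<close> vanishes on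
  \<open>A\<close>.\<close>

lemma std_component_less:
  assumes "finite V" "\<And>a. a \<in> A \<Longrightarrow> a $ i \<in> V" "e \<in> std A"
  shows "e $ i < card V"
proof (rule ccontr)
  assume "\<not> e $ i < card V"
  then have "axis i (card V) \<in> std A"
    using assms(3) by (intro std_lower[OF assms(3)]) (auto simp: axis_def)
  moreover have "axis i (card V) \<notin> std A"
  proof (rule nonstandardI)
    have "{axis i j |j. j < card V} \<subseteq> below (axis i (card V))"
      using axis_below by auto
    then show "(\<lambda>x. (-1) * ((\<Prod>v\<in>V. x $ i - v) - mon (axis i (card V)) x)) \<in> polyfun (below (axis i (card V)))"
      by (intro polyfun_scale polyfun_mono[OF _ prod_linear_factors[OF assms(1)]])
    show "mon (axis i (card V)) x = (-1) * ((\<Prod>v\<in>V. x $ i - v) - mon (axis i (card V)) x)"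
      if "x \<in> A" for x
      using assms(1,2) that by (auto simp: prod_zero_iff)
  qed
  ultimately show False by simp
qed

end

section \<open>Counting points of dyadic grids\<close>

lemma dyadic_floor_tendsto: "(\<lambda>k. of_int \<lfloor>2 ^ k * t\<rfloor> / 2 ^ k) \<longlonglongrightarrow> (t :: real)"
proof (rule tendsto_sandwich)
  show "\<forall>\<^sub>F k in sequentially. t - 1 / 2 ^ k \<le> of_int \<lfloor>2 ^ k * t\<rfloor> / 2 ^ k"
  proof (rule always_eventually, rule allI)
    fix k :: nat
    have "2 ^ k * t \<le> of_int \<lfloor>2 ^ k * t\<rfloor> + 1"
      by linarith
    then have "t \<le> (of_int \<lfloor>2 ^ k * t\<rfloor> + 1) / 2 ^ k"
      by (simp add: pos_le_divide_eq mult.commute)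
    then show "t - 1 / 2 ^ k \<le> of_int \<lfloor>2 ^ k * t\<rfloor> / 2 ^ k"
      by (simp add: add_divide_distrib)
  qed
  show "\<forall>\<^sub>F k in sequentially. of_int \<lfloor>2 ^ k * t\<rfloor> / 2 ^ k \<le> t"
  proof (rule always_eventually, rule allI)
    fix k :: nat
    have "of_int \<lfloor>2 ^ k * t\<rfloor> \<le> 2 ^ k * t"
      by linarith
    then show "of_int \<lfloor>2 ^ k * t\<rfloor> / 2 ^ k \<le> t"
      by (simp add: field_simps)
  qed
  have "(\<lambda>k. t - 1 / 2 ^ k) \<longlonglongrightarrow> t - 0"
    by (intro tendsto_diff tendsto_const LIMSEQ_divide_realpow_zero) simp
  then show "(\<lambda>k. t - 1 / 2 ^ k) \<longlonglongrightarrow> t"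
    by simp
qed simp

text \<open>Iterated midpoints reach all dyadic points of a segment; these are dense in it, and
  \<open>S\<close> is closed.\<close>

lemma convex_if_closed_midpoint:
  fixes S :: "'a::real_normed_vector set"
  assumes "closed S" and mid: "\<And>x y. x \<in> S \<Longrightarrow> y \<in> S \<Longrightarrow> (1 / 2) *\<^sub>R (x + y) \<in> S"
  shows "convex S"
proof -
  have dyadic: "x + (real m / 2 ^ k) *\<^sub>R (y - x) \<in> S" if "x \<in> S" "y \<in> S" "m \<le> 2 ^ k" for x y m k
    using that(3)
  proof (induction k arbitrary: m)
    case 0
    then have "m = 0 \<or> m = 1" by auto
    then show ?case using that by auto
  next
    case (Suc k)
    \<comment> \<open>Halving \<open>m\<close> up to rounding keeps both parts at most
      \<open>2 ^ k\<close>; the point for \<open>m / 2 ^ Suc k\<close> is the midpoint of those for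
      \<open>p / 2 ^ k\<close> and \<open>q / 2 ^ k\<close>.\<close>
    define p q where "p = m div 2" and "q = m - m div 2"
    have pq: "p \<le> 2 ^ k" "q \<le> 2 ^ k" "m = p + q"
      using Suc.prems by (auto simp: p_def q_def)
    have "(1 / 2) *\<^sub>R ((x + (real p / 2 ^ k) *\<^sub>R (y - x)) + (x + (real q / 2 ^ k) *\<^sub>R (y - x))) \<in> S"
      using pq by (intro mid Suc.IH)
    also have "(1 / 2) *\<^sub>R ((x + (real p / 2 ^ k) *\<^sub>R (y - x)) + (x + (real q / 2 ^ k) *\<^sub>R (y - x)))
        = (1 / 2) *\<^sub>R (2 *\<^sub>R x + (real p / 2 ^ k + real q / 2 ^ k) *\<^sub>R (y - x))"
      by (simp only: scaleR_add_left scaleR_2 add_ac)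
    also have "\<dots> = x + (real m / 2 ^ Suc k) *\<^sub>R (y - x)"
      by (simp add: scaleR_add_right pq(3) add_divide_distrib)
    finally show ?case .
  qed
  show ?thesis
    unfolding convex_alt
  proof (intro ballI allI impI)
    fix x y and u :: real assume xy: "x \<in> S" "y \<in> S" and u: "0 \<le> u \<and> u \<le> 1"
    have "x + (of_int \<lfloor>2 ^ k * u\<rfloor> / 2 ^ k) *\<^sub>R (y - x) \<in> S" for k
    proof -
      have "2 ^ k * u \<le> 2 ^ k" using u by simp
      then have "\<lfloor>2 ^ k * u\<rfloor> \<le> 2 ^ k" using floor_mono[of "2 ^ k * u" "2 ^ k"] by simp
      moreover have "0 \<le> \<lfloor>2 ^ k * u\<rfloor>" using u by simp
      ultimately have "nat \<lfloor>2 ^ k * u\<rfloor> \<le> 2 ^ k" "real (nat \<lfloor>2 ^ k * u\<rfloor>) = of_int \<lfloor>2 ^ k * u\<rfloor>"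
        by (simp_all add: nat_le_iff)
      then show ?thesis
        using dyadic[OF xy, of "nat \<lfloor>2 ^ k * u\<rfloor>" k] by simp
    qed
    moreover have "(\<lambda>k. x + (of_int \<lfloor>2 ^ k * u\<rfloor> / 2 ^ k) *\<^sub>R (y - x)) \<longlonglongrightarrow> x + u *\<^sub>R (y - x)"
      by (intro tendsto_intros dyadic_floor_tendsto)
    ultimately have "x + u *\<^sub>R (y - x) \<in> S"
      by (rule closed_sequentially[OF assms(1)])
    then show "(1 - u) *\<^sub>R x + u *\<^sub>R y \<in> S"
      by (simp add: algebra_simps)
  qed
qed

section \<open>Rounding to dyadic grids and volumes of grid cubes\<close>

text \<open>The lower corner of the half-open dyadic cube of side \<open>1 / 2 ^ k\<close> that
  contains \<open>x\<close>.\<close>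

definition grid_floor :: "nat \<Rightarrow> real ^ 'n \<Rightarrow> real ^ 'n" where
  "grid_floor k x = (\<chi> i. of_int \<lfloor>2 ^ k * x $ i\<rfloor> / 2 ^ k)"

lemma grid_floor_le: "grid_floor k x $ i \<le> x $ i"
  and grid_floor_gt: "x $ i < grid_floor k x $ i + 1 / 2 ^ k"
proof -
  have "of_int \<lfloor>2 ^ k * x $ i\<rfloor> \<le> 2 ^ k * x $ i" "2 ^ k * x $ i < of_int \<lfloor>2 ^ k * x $ i\<rfloor> + 1"
    by linarith+
  then show "grid_floor k x $ i \<le> x $ i" "x $ i < grid_floor k x $ i + 1 / 2 ^ k"
    by (simp_all add: grid_floor_def field_simps)
qed

lemma grid_floor_tendsto: "(\<lambda>k. grid_floor k x) \<longlonglongrightarrow> x"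
  by (rule vec_tendstoI) (simp add: grid_floor_def dyadic_floor_tendsto)

lemma scaled_integer_in_range_grid_floor: "2 ^ k *\<^sub>R a \<in> integer_points \<Longrightarrow> a \<in> range (grid_floor k)"
proof -
  assume "2 ^ k *\<^sub>R a \<in> integer_points"
  then have "2 ^ k * a $ i \<in> \<int>" for i by (simp add: integer_points_def)
  then have "grid_floor k a = a"
    by (simp add: grid_floor_def vec_eq_iff field_simps Ints_def)
  then show ?thesis by (metis rangeI)
qed

lemma scaled_grid_floor_integer: "2 ^ k *\<^sub>R grid_floor k x \<in> integer_points"
  by (simp add: integer_points_def grid_floor_def)

lemma finite_bounded_integer_points:
  assumes "bounded A"
  shows "finite (A \<inter> integer_points)"
proof -
  obtain B where B: "\<And>x. x \<in> A \<Longrightarrow> norm x \<le> B"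
    using assms bounded_iff by blast
  have "A \<inter> integer_points \<subseteq> vec_lambda ` (\<Pi>\<^sub>E i\<in>UNIV. {k \<in> \<int>. \<bar>k\<bar> \<le> B})"
  proof
    fix x assume x: "x \<in> A \<inter> integer_points"
    have "\<bar>x $ i\<bar> \<le> B" for i
      using B[of x] x component_le_norm_cart[of x i] by auto
    then show "x \<in> vec_lambda ` (\<Pi>\<^sub>E i\<in>UNIV. {k \<in> \<int>. \<bar>k\<bar> \<le> B})"
      using x by (intro image_eqI[of _ _ "($) x"]) (auto simp: integer_points_def PiE_iff)
  qed
  then show ?thesis
    by (rule finite_subset) (intro finite_imageI finite_PiE finite_abs_int_segment finite)
qed

lemma finite_bounded_grid:
  assumes "bounded D" "D \<subseteq> range (grid_floor k)"
  shows "finite D"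
proof -
  have "finite (((\<lambda>x. 2 ^ k *\<^sub>R x) ` D) \<inter> integer_points)"
    by (intro finite_bounded_integer_points bounded_scaling assms)
  moreover have "(\<lambda>x. 2 ^ k *\<^sub>R x) ` D \<subseteq> integer_points"
    using assms(2) scaled_grid_floor_integer by blast
  ultimately have "finite ((\<lambda>x. 2 ^ k *\<^sub>R x) ` D)"
    by (simp add: Int_absorb2)
  then show ?thesis
    by (rule finite_imageD) (simp add: inj_on_def)
qed

text \<open>The fibre is a half-open cube, squeezed between an open box and its closure, which
  differ by a null set.\<close>

lemma grid_cube:
  fixes y :: "real ^ 'n::finite" and k :: nat
  defines "a \<equiv> grid_floor k y"
  shows "{x. grid_floor k x = a} \<in> lmeasurable"
    and "measure lebesgue {x. grid_floor k x = a} = 1 / 2 ^ (k * CARD('n))"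
proof -
  let ?H = "{x. grid_floor k x = a}"
  define b :: "real ^ 'n" where "b = (\<chi> i. a $ i + 1 / 2 ^ k)"
  have sub: "?H \<subseteq> cbox a b"
    using grid_floor_le[of k _] less_imp_le[OF grid_floor_gt[of _ _ k]] by (auto simp: mem_box_cart b_def)
  have sup: "box a b \<subseteq> ?H"
  proof
    fix x assume x: "x \<in> box a b"
    have "\<lfloor>2 ^ k * x $ i\<rfloor> = \<lfloor>2 ^ k * y $ i\<rfloor>" for i
    proof (rule floor_unique)
      have "a $ i < x $ i" "x $ i < a $ i + 1 / 2 ^ k"
        using x by (auto simp: mem_box_cart b_def)
      then show "of_int \<lfloor>2 ^ k * y $ i\<rfloor> \<le> 2 ^ k * x $ i" "2 ^ k * x $ i < of_int \<lfloor>2 ^ k * y $ i\<rfloor> + 1"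
        by (simp_all add: a_def grid_floor_def field_simps)
    qed
    then show "x \<in> ?H" by (simp add: a_def grid_floor_def)
  qed
  have neg: "negligible ((cbox a b - ?H) \<union> (?H - cbox a b))"
    by (rule negligible_subset[OF negligible_frontier_interval[of a b]]) (use sub sup in blast)
  show "?H \<in> lmeasurable"
    by (rule lmeasurable_negligible_symdiff[OF lmeasurable_cbox neg])
  have "measure lebesgue ?H = measure lebesgue (cbox a b)"
    by (rule measure_negligible_symdiff[OF _ neg]) simp
  also have "\<dots> = (\<Prod>i\<in>UNIV. b $ i - a $ i)"
  proof -
    have "a \<in> cbox a b" by (simp add: mem_box_cart b_def)
    then show ?thesis by (subst content_cbox_cart[symmetric]) auto
  qed
  also have "\<dots> = 1 / 2 ^ (k * CARD('n))"
    by (simp add: b_def power_mult power_one_over)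
  finally show "measure lebesgue ?H = 1 / 2 ^ (k * CARD('n))" .
qed

lemma grid_measure:
  fixes D :: "(real ^ 'n::finite) set"
  assumes "finite D" "D \<subseteq> range (grid_floor k)"
  shows "{x. grid_floor k x \<in> D} \<in> lmeasurable \<and>
    measure lebesgue {x. grid_floor k x \<in> D} = real (card D) / 2 ^ (k * CARD('n))"
  using assms
proof induction
  case empty
  then show ?case by simp
next
  case (insert a D)
  let ?H = "{x. grid_floor k x = a}" and ?G = "{x. grid_floor k x \<in> D}"
  obtain y where y: "a = grid_floor k y" using insert.prems by blast
  have split: "{x. grid_floor k x \<in> insert a D} = ?H \<union> ?G" and disj: "?H \<inter> ?G = {}"
    using insert.hyps by auto
  have "?H \<in> lmeasurable" "?G \<in> lmeasurable"
    using insert grid_cube(1)[of k y] y by auto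
  then show ?case
    unfolding split using insert grid_cube(2)[of k y] y disj
    by (auto simp: measure_Un3 add_divide_distrib)
qed

text \<open>A crude bound, but uniform in \<open>k\<close>, which is what a common dominating ball
  requires.\<close>

lemma norm_grid_floor_diff: "norm (x - grid_floor k x) \<le> real CARD('n)" for x :: "real ^ 'n::finite"
proof -
  have "norm (x - grid_floor k x) \<le> (\<Sum>i\<in>UNIV. \<bar>(x - grid_floor k x) $ i\<bar>)"
    by (rule norm_le_l1_cart)
  also have "\<dots> \<le> (\<Sum>i\<in>(UNIV :: 'n set). 1)"
  proof (rule sum_mono)
    fix i
    have "1 / (2::real) ^ k \<le> 1" by simp
    then have "x $ i \<le> grid_floor k x $ i + 1"
      using grid_floor_gt[of x i k] by linarith
    then show "\<bar>(x - grid_floor k x) $ i\<bar> \<le> 1"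
      using grid_floor_le[of k x i] by simp
  qed
  finally show ?thesis by simp
qed

text \<open>The normalised counts are volumes of unions of grid cubes. Their indicators converge to
  that of \<open>S\<close> off the null frontier and are supported in one ball, so dominated
  convergence applies. With \<open>D\<close> arbitrary, this covers both lattice points and standard
  exponents.\<close>

lemma grid_count_limit:
  fixes S :: "(real ^ 'n::finite) set"
  assumes "bounded S" "negligible (frontier S)"
    and grid: "\<And>k. D k \<subseteq> range (grid_floor k)" and bound: "\<And>k. D k \<subseteq> cball 0 R"
    and inside: "\<And>x. x \<in> interior S \<Longrightarrow> \<forall>\<^sub>F k in sequentially. grid_floor k x \<in> D k"
    and outside: "\<And>x. x \<notin> closure S \<Longrightarrow> \<forall>\<^sub>F k in sequentially. grid_floor k x \<notin> D k"
  shows "(\<lambda>k. real (card (D k)) / 2 ^ (k * CARD('n))) \<longlonglongrightarrow> measure lebesgue S"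
proof -
  define C where "C k = {x. grid_floor k x \<in> D k}" for k
  have "bounded (D k)" for k
    using bound bounded_cball bounded_subset by blast
  then have fin: "finite (D k)" for k
    using finite_bounded_grid grid by blast
  have C: "C k \<in> lmeasurable" "measure lebesgue (C k) = real (card (D k)) / 2 ^ (k * CARD('n))" for k
    using grid_measure[OF fin grid] by (auto simp: C_def)
  have S: "S \<in> lmeasurable"
    using assms(1,2) by (simp add: measurable_Jordan)
  \<comment> \<open>Points of \<open>D k\<close> have norm at most \<open>R\<close>, and rounding
    moves a point by at most \<open>CARD('n)\<close>.\<close>
  let ?B = "cball (0 :: real ^ 'n) (R + real CARD('n))"
  have CB: "C k \<subseteq> ?B" for k
  proof
    fix x assume "x \<in> C k"
    then have "norm (grid_floor k x) \<le> R"
      using bound[of k] by (auto simp: C_def)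
    moreover have "norm x \<le> norm (grid_floor k x) + norm (x - grid_floor k x)"
      using norm_triangle_ineq[of "grid_floor k x" "x - grid_floor k x"] by simp
    ultimately show "x \<in> ?B" using norm_grid_floor_diff[of x k] by simp
  qed
  have "(\<lambda>k. integral\<^sup>L lebesgue (indicat_real (C k))) \<longlonglongrightarrow> integral\<^sup>L lebesgue (indicat_real S)"
  proof (rule integral_dominated_convergence[where w = "indicat_real ?B"])
    show "indicat_real S \<in> borel_measurable lebesgue"
      using S by (intro borel_measurable_indicator) auto
    show "indicat_real (C k) \<in> borel_measurable lebesgue" for k
      using C(1) by (intro borel_measurable_indicator) auto
    show "integrable lebesgue (indicat_real ?B)"
      using lmeasurable_cball[of 0 "R + real CARD('n)"]
      by (intro integrable_real_indicator fmeasurableD) (auto simp: fmeasurable_def)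
    have "AE x in lebesgue. x \<notin> frontier S"
      using assms(2) by (intro AE_not_in) (simp add: negligible_iff_null_sets)
    then show "AE x in lebesgue. (\<lambda>k. indicat_real (C k) x) \<longlonglongrightarrow> indicat_real S x"
    proof eventually_elim
      case (elim x)
      then consider "x \<in> interior S" | "x \<notin> closure S"
        by (auto simp: frontier_def)
      then show ?case
      proof cases
        case 1
        then have "x \<in> S" using interior_subset by blast
        show ?thesis
          by (rule tendsto_eventually, rule eventually_mono[OF inside[OF 1]])
             (use \<open>x \<in> S\<close> in \<open>simp add: C_def\<close>)
      next
        case 2
        then have "x \<notin> S" using closure_subset by blast
        show ?thesis
          by (rule tendsto_eventually, rule eventually_mono[OF outside[OF 2]])
             (use \<open>x \<notin> S\<close> in \<open>simp add: C_def\<close>)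
      qed
    qed
    show "AE x in lebesgue. norm (indicat_real (C k) x) \<le> indicat_real ?B x" for k
      using CB[of k] by (intro AE_I2) (auto simp: indicator_def)
  qed
  then show ?thesis
    using C by simp
qed

section \<open>Volumes under affine maps and closed subsets of full measure\<close>

lemma measure_affine:
  fixes S :: "(real ^ 'n::finite) set"
  shows "measure lebesgue ((\<lambda>x. m *\<^sub>R x + v) ` S) = \<bar>m\<bar> ^ CARD('n) * measure lebesgue S"
  using measure_lebesgue_affine[of m v S] by simp

lemma measure_scale:
  fixes S :: "(real ^ 'n::finite) set"
  shows "measure lebesgue ((\<lambda>x. m *\<^sub>R x) ` S) = \<bar>m\<bar> ^ CARD('n) * measure lebesgue S"
  using measure_affine[of m 0 S] by simp

lemma measure_shift:
  fixes S :: "(real ^ 'n::finite) set"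
  shows "measure lebesgue ((\<lambda>x. x + v) ` S) = measure lebesgue S"
  using measure_affine[of 1 v S] by simp

lemma interior_nonempty_if_measure_pos:
  fixes S :: "'a::euclidean_space set"
  assumes "convex S" "measure lebesgue S > 0"
  shows "interior S \<noteq> {}"
  using assms negligible_convex_interior[of S] negligible_imp_measure0[of S] by auto

text \<open>A point of \<open>S - T\<close> would have a neighbourhood missing \<open>T\<close>, which meets the interior of \<open>S\<close>.\<close>

lemma closed_subset_full_measure:
  fixes S T :: "'a::euclidean_space set"
  assumes "convex S" "bounded S" "measure lebesgue S > 0" "closed T" "T \<subseteq> S"
    and "measure lebesgue S \<le> measure lebesgue T"
  shows "T = S"
proof (rule ccontr)
  assume "T \<noteq> S"
  then obtain x where x: "x \<in> S" "x \<notin> T" using assms(5) by blast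
  define U where "U = - T \<inter> interior S"
  have "x \<in> closure (interior S)"
    using x(1) closure_subset convex_closure_interior[OF assms(1)]
      interior_nonempty_if_measure_pos[OF assms(1,3)] by blast
  then have "U \<noteq> {}"
    unfolding U_def using x(2) assms(4) open_Int_closure_eq_empty[of "- T" "interior S"] by auto
  moreover have "open U"
    unfolding U_def using assms(4) by (intro open_Int open_interior) auto
  ultimately have "\<not> negligible U"
    using open_not_negligible by blast
  have S: "S \<in> lmeasurable"
    using assms(1,2) by (rule measurable_convex)
  have "bounded U" "bounded T"
    using assms(2,5) interior_subset by (auto simp: U_def intro: bounded_subset)
  then have U: "U \<in> lmeasurable" and T: "T \<in> lmeasurable"
    using \<open>open U\<close> assms(4) by (auto simp: lmeasurable_open compact_eq_bounded_closed lmeasurable_compact)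
  have "measure lebesgue U > 0"
    using \<open>\<not> negligible U\<close> U by (simp add: negligible_iff_measure zero_less_measure_iff)
  moreover have "measure lebesgue (T \<union> U) = measure lebesgue T + measure lebesgue U"
    using measure_Un3[OF T U] by (simp add: U_def Int_assoc[symmetric])
  moreover have "measure lebesgue (T \<union> U) \<le> measure lebesgue S"
    by (rule measure_mono_fmeasurable)
       (use assms(5) interior_subset[of S] S T U in \<open>auto simp: U_def\<close>)
  ultimately show False using assms(6) by simp
qed

section \<open>The limit shape\<close>

text \<open>The scale is an arbitrary real because, besides powers of two, multiples
  \<open>m * 2 ^ k\<close> and products with a real dilation factor occur.\<close>

definition lattice_points :: "real \<Rightarrow> (real ^ 'n) set \<Rightarrow> (real ^ 'n) set" where
  "lattice_points s P = (\<lambda>x. s *\<^sub>R x) ` P \<inter> integer_points"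

lemma finite_lattice_points: "bounded P \<Longrightarrow> finite (lattice_points s P)" for P :: "(real ^ 'n::finite) set"
  unfolding lattice_points_def by (intro finite_bounded_integer_points bounded_scaling)

text \<open>The vector \<open>s x + t y\<close> is \<open>s + t\<close> times a weighted mean of
  \<open>x\<close> and \<open>y\<close>, which lies in \<open>P\<close> by convexity.\<close>

lemma lattice_points_add:
  assumes "convex P" "s > 0" "t > 0" "a \<in> lattice_points s P" "b \<in> lattice_points t P"
  shows "a + b \<in> lattice_points (s + t) P"
proof -
  obtain x y where xy: "a = s *\<^sub>R x" "b = t *\<^sub>R y" "x \<in> P" "y \<in> P"
    using assms(4,5) by (auto simp: lattice_points_def)
  have "(s / (s + t)) *\<^sub>R x + (t / (s + t)) *\<^sub>R y \<in> P"
    using assms(2,3) xy by (intro convexD[OF assms(1)]) (auto simp: add_divide_distrib[symmetric])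
  moreover have "a + b = (s + t) *\<^sub>R ((s / (s + t)) *\<^sub>R x + (t / (s + t)) *\<^sub>R y)"
    using assms(2,3) by (simp add: xy scaleR_add_right)
  moreover have "a + b \<in> integer_points"
    using assms(4,5) by (auto simp: lattice_points_def integer_points_def)
  ultimately show ?thesis
    unfolding lattice_points_def by blast
qed

lemma convex_affine_image: "convex P \<Longrightarrow> convex ((\<lambda>x. t *\<^sub>R x + v) ` P)"
  for P :: "'a::real_vector set"
  using convex_affinity[of P v t] by (simp add: add.commute)

lemma bounded_affine_image: "bounded P \<Longrightarrow> bounded ((\<lambda>x. t *\<^sub>R x + v) ` P)"
  for P :: "'a::real_normed_vector set"
  using bounded_translation[OF bounded_scaling[of P t], of v] by (simp add: image_image add.commute)

lemma real_vec_nth [simp]: "real_vec e $ i = real (e $ i)"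
  by (simp add: real_vec_def)

lemma inj_real_vec: "inj real_vec"
  by (rule injI) (simp add: vec_eq_iff)

text \<open>As rounding converges to the identity, interior points eventually round into
  \<open>P\<close> and exterior points out of it; the frontier of a convex set is null.\<close>

lemma lattice_count_limit:
  fixes P :: "(real ^ 'n::finite) set"
  assumes "convex P" "bounded P"
  shows "(\<lambda>k. real (card (lattice_points (2 ^ k) P)) / 2 ^ (k * CARD('n))) \<longlonglongrightarrow> measure lebesgue P"
proof -
  define D where "D k = (\<lambda>x. (1 / 2 ^ k) *\<^sub>R x) ` lattice_points (2 ^ k) P" for k :: nat
  obtain B where B: "\<And>x. x \<in> P \<Longrightarrow> norm x \<le> B"
    using assms(2) bounded_iff by blast
  have D: "x \<in> D k \<longleftrightarrow> x \<in> P \<and> 2 ^ k *\<^sub>R x \<in> integer_points" for x k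
    unfolding D_def lattice_points_def by (force simp: image_iff)
  have "(\<lambda>k. real (card (D k)) / 2 ^ (k * CARD('n))) \<longlonglongrightarrow> measure lebesgue P"
  proof (rule grid_count_limit[OF assms(2)])
    show "negligible (frontier P)"
      using assms(1) by (rule negligible_convex_frontier)
    show "D k \<subseteq> range (grid_floor k)" for k
      using D scaled_integer_in_range_grid_floor by blast
    show "D k \<subseteq> cball 0 B" for k
      using D B by auto
    fix x
    show "\<forall>\<^sub>F k in sequentially. grid_floor k x \<in> D k" if "x \<in> interior P"
      using topological_tendstoD[OF grid_floor_tendsto open_interior that]
      by (rule eventually_mono) (use D scaled_grid_floor_integer interior_subset in blast)
    show "\<forall>\<^sub>F k in sequentially. grid_floor k x \<notin> D k" if "x \<notin> closure P"
    proof -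
      have "x \<in> - closure P" "open (- closure P)"
        using that by auto
      from topological_tendstoD[OF grid_floor_tendsto this(2,1)] show ?thesis
        by (rule eventually_mono) (use D closure_subset in blast)
    qed
  qed
  moreover have "card (D k) = card (lattice_points (2 ^ k) P)" for k
    unfolding D_def by (rule card_image) (simp add: inj_on_def)
  ultimately show ?thesis by simp
qed

section \<open>The ascending chain and convexity of the limit shape\<close>

context monomial_ordering
begin

abbreviation shape :: "(real ^ 'n) set \<Rightarrow> (real ^ 'n) set" where
  "shape \<equiv> limit_shape r"

definition grid_shape :: "nat \<Rightarrow> (real ^ 'n) set \<Rightarrow> (real ^ 'n) set" where
  "grid_shape k P = (\<lambda>e. (1 / 2 ^ k) *\<^sub>R real_vec e) ` std (lattice_points (2 ^ k) P)"

lemma shape_eq: "shape P = closure (\<Union>k. grid_shape k P)"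
  by (simp add: limit_shape_def grid_shape_def lattice_points_def)

lemma closed_shape: "closed (shape P)"
  by (simp add: shape_eq)

lemma grid_shape_subset_shape: "grid_shape k P \<subseteq> shape P"
  unfolding shape_eq using closure_subset by fast

lemma shape_minimal: "(\<And>k. grid_shape k P \<subseteq> S) \<Longrightarrow> closed S \<Longrightarrow> shape P \<subseteq> S"
  unfolding shape_eq by (intro closure_minimal) auto

lemma std_lattice_points_add:
  assumes "convex P" "bounded P" "s > 0" "t > 0"
    "e \<in> std (lattice_points s P)" "f \<in> std (lattice_points t P)"
  shows "e + f \<in> std (lattice_points (s + t) P)"
  using assms lattice_points_add
  by (intro std_add[of "lattice_points s P" "lattice_points t P"] finite_lattice_points) auto

text \<open>Repeated addition of \<open>e\<close>; counting with \<open>Suc m\<close> keeps all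
  scales positive, as the addition lemma demands.\<close>

lemma std_lattice_points_multiple:
  assumes "convex P" "bounded P" "s > 0" "e \<in> std (lattice_points s P)"
  shows "(\<chi> i. Suc m * e $ i) \<in> std (lattice_points (real (Suc m) * s) P)"
proof (induction m)
  case 0
  then show ?case using assms(4) by simp
next
  case (Suc m)
  have "(\<chi> i. Suc m * e $ i) + e \<in> std (lattice_points (real (Suc m) * s + s) P)"
    using assms Suc by (intro std_lattice_points_add) auto
  moreover have "(\<chi> i. Suc m * e $ i) + e = (\<chi> i. Suc (Suc m) * e $ i)"
    by (simp add: vec_eq_iff)
  moreover have "real (Suc m) * s + s = real (Suc (Suc m)) * s"
    by (simp add: algebra_simps)
  ultimately show ?case by simp
qed

lemma grid_shape_multiple:
  assumes "convex P" "bounded P" "x \<in> grid_shape k P" "m > 0"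
  obtains e where "e \<in> std (lattice_points (real m * 2 ^ k) P)" "real_vec e = (real m * 2 ^ k) *\<^sub>R x"
proof -
  obtain f where f: "f \<in> std (lattice_points (2 ^ k) P)" "x = (1 / 2 ^ k) *\<^sub>R real_vec f"
    using assms(3) by (auto simp: grid_shape_def)
  obtain l where l: "m = Suc l"
    using assms(4) gr0_implies_Suc by blast
  have "(\<chi> i. m * f $ i) \<in> std (lattice_points (real m * 2 ^ k) P)"
    using std_lattice_points_multiple[OF assms(1,2) _ f(1), of l] by (simp add: l)
  moreover have "real_vec (\<chi> i. m * f $ i) = (real m * 2 ^ k) *\<^sub>R x"
    by (simp add: f(2) vec_eq_iff)
  ultimately show ?thesis by (rule that)
qed

text \<open>The chain property: multiplying an exponent of level \<open>k\<close> by
  \<open>2 ^ (j - k)\<close> yields an exponent of level \<open>j\<close> with the same rescaled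
  point.\<close>

lemma grid_shape_mono:
  assumes "convex P" "bounded P" "k \<le> j"
  shows "grid_shape k P \<subseteq> grid_shape j P"
proof
  fix x assume "x \<in> grid_shape k P"
  then obtain e where e: "e \<in> std (lattice_points (real (2 ^ (j - k)) * 2 ^ k) P)"
    "real_vec e = (real (2 ^ (j - k)) * 2 ^ k) *\<^sub>R x"
    using grid_shape_multiple[OF assms(1,2), of x k "2 ^ (j - k)"] by auto
  have "real (2 ^ (j - k)) * 2 ^ k = 2 ^ j"
    using assms(3) by (simp add: power_add[symmetric])
  then show "x \<in> grid_shape j P"
    using e unfolding grid_shape_def by (intro image_eqI[of _ _ e]) auto
qed

text \<open>The sum of two exponents of level \<open>k\<close> is an exponent of level
  \<open>Suc k\<close>, and the finer rescaling supplies the factor one half.\<close>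

lemma grid_shape_midpoint:
  assumes "convex P" "bounded P" "x \<in> grid_shape k P" "y \<in> grid_shape k P"
  shows "(1 / 2) *\<^sub>R (x + y) \<in> grid_shape (Suc k) P"
proof -
  obtain e f where ef: "e \<in> std (lattice_points (2 ^ k) P)" "x = (1 / 2 ^ k) *\<^sub>R real_vec e"
    "f \<in> std (lattice_points (2 ^ k) P)" "y = (1 / 2 ^ k) *\<^sub>R real_vec f"
    using assms(3,4) unfolding grid_shape_def by blast
  have "e + f \<in> std (lattice_points (2 ^ k + 2 ^ k) P)"
    using assms(1,2) ef by (intro std_lattice_points_add) auto
  moreover have "(2::real) ^ k + 2 ^ k = 2 ^ Suc k"
    by simp
  ultimately have "e + f \<in> std (lattice_points (2 ^ Suc k) P)"
    by (simp only:)
  moreover have "(1 / 2) *\<^sub>R (x + y) = (1 / 2 ^ Suc k) *\<^sub>R real_vec (e + f)"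
    unfolding ef(2,4) vec_eq_iff by (simp add: field_simps)
  ultimately show ?thesis
    unfolding grid_shape_def by (intro image_eqI[of _ _ "e + f"])
qed

text \<open>Two approximating points can be moved to a common level of the chain, where their
  midpoint is available on the next level; closedness passes this to limits.\<close>

lemma convex_shape:
  assumes "convex P" "bounded P"
  shows "convex (shape P)"
proof (rule convex_if_closed_midpoint[OF closed_shape])
  let ?U = "\<Union>k. grid_shape k P"
  fix x y assume "x \<in> shape P" "y \<in> shape P"
  then have "\<exists>u. (\<forall>n. u n \<in> ?U) \<and> u \<longlonglongrightarrow> x" "\<exists>v. (\<forall>n. v n \<in> ?U) \<and> v \<longlonglongrightarrow> y"
    by (simp_all only: shape_eq closure_sequential)
  then obtain u v where u: "\<And>n. u n \<in> ?U" "u \<longlonglongrightarrow> x" and v: "\<And>n. v n \<in> ?U" "v \<longlonglongrightarrow> y"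
    by auto
  have "(1 / 2) *\<^sub>R (u n + v n) \<in> shape P" for n
  proof -
    obtain j k where "u n \<in> grid_shape j P" "v n \<in> grid_shape k P"
      using u(1)[of n] v(1)[of n] by auto
    then have "u n \<in> grid_shape (max j k) P" "v n \<in> grid_shape (max j k) P"
      using grid_shape_mono[OF assms, of j "max j k"] grid_shape_mono[OF assms, of k "max j k"] by auto
    then show ?thesis
      using grid_shape_midpoint[OF assms] grid_shape_subset_shape by blast
  qed
  moreover have "(\<lambda>n. (1 / 2) *\<^sub>R (u n + v n)) \<longlonglongrightarrow> (1 / 2) *\<^sub>R (x + y)"
    by (intro tendsto_intros u v)
  ultimately show "(1 / 2) *\<^sub>R (x + y) \<in> shape P"
    by (rule closed_sequentially[OF closed_shape])
qed

section \<open>Boundedness and compactness\<close>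

lemma shape_nonneg:
  assumes "x \<in> shape P"
  shows "0 \<le> x $ i"
proof -
  have "shape P \<subseteq> {x. 0 \<le> x $ i}"
  proof (rule shape_minimal)
    show "grid_shape k P \<subseteq> {x. 0 \<le> x $ i}" for k
      by (auto simp: grid_shape_def)
    show "closed {x :: real ^ 'n. 0 \<le> x $ i}"
      by (intro closed_Collect_le continuous_intros)
  qed
  then show ?thesis using assms by blast
qed

text \<open>If all points of \<open>P\<close> have norm at most \<open>B\<close>, then lattice
  points of \<open>2 ^ k * P\<close> take at most \<open>2 * 2 ^ k * B + 1\<close> values in each
  coordinate. This bounds the exponents, uniformly in \<open>k\<close> after division by
  \<open>2 ^ k\<close>.\<close>

lemma grid_shape_bounded:
  assumes "bounded P"
  obtains R where "\<And>k. grid_shape k P \<subseteq> cball 0 R"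
proof -
  obtain B0 where B0: "\<And>x. x \<in> P \<Longrightarrow> norm x \<le> B0"
    using assms bounded_iff by blast
  \<comment> \<open>Rounding up makes the endpoints of the range of coordinate values
    integers.\<close>
  define B where "B = nat \<lceil>B0\<rceil>"
  have B: "norm x \<le> real B" if "x \<in> P" for x
    using B0[OF that] unfolding B_def by linarith
  have "grid_shape k P \<subseteq> cball 0 (real CARD('n) * (2 * real B))" for k
  proof
    fix x assume "x \<in> grid_shape k P"
    then obtain e where e: "e \<in> std (lattice_points (2 ^ k) P)" "x = (1 / 2 ^ k) *\<^sub>R real_vec e"
      by (auto simp: grid_shape_def)
    have comp: "\<bar>x $ i\<bar> \<le> 2 * real B" for i
    proof -
      let ?V = "real_of_int ` {- (2 ^ k * int B)..2 ^ k * int B}"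
      have "e $ i < card ?V"
      proof (rule std_component_less[OF _ _ e(1)])
        show "finite ?V" by simp
        fix a assume "a \<in> lattice_points (2 ^ k) P"
        then obtain y where y: "y \<in> P" "a = 2 ^ k *\<^sub>R y" "a $ i \<in> \<int>"
          by (auto simp: lattice_points_def integer_points_def)
        obtain z where z: "a $ i = of_int z"
          using y(3) by (auto elim: Ints_cases)
        have "\<bar>y $ i\<bar> \<le> real B"
          using B[OF y(1)] component_le_norm_cart[of y i] by linarith
        then have "2 ^ k * \<bar>y $ i\<bar> \<le> 2 ^ k * real B"
          by (intro mult_left_mono) auto
        moreover have "real_of_int z = 2 ^ k * y $ i"
          using z by (simp add: y(2))
        ultimately have "\<bar>real_of_int z\<bar> \<le> 2 ^ k * real B"
          by (simp add: abs_mult)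
        then have "real_of_int \<bar>z\<bar> \<le> real_of_int (2 ^ k * int B)"
          by simp
        then have "\<bar>z\<bar> \<le> 2 ^ k * int B"
          by (simp only: of_int_le_iff)
        then show "a $ i \<in> ?V"
          unfolding z by (intro imageI) auto
      qed
      also have "card ?V = nat (2 * (2 ^ k * int B) + 1)"
        by (subst card_image) (auto simp: inj_on_def mult_ac)
      \<comment> \<open>The strict inequality for the exponent absorbs the \<open>+ 1\<close> in the
        count.\<close>
      finally have "int (e $ i) \<le> 2 * (2 ^ k * int B)"
        by linarith
      then have "real_of_int (int (e $ i)) \<le> real_of_int (2 * (2 ^ k * int B))"
        by (simp only: of_int_le_iff)
      then show ?thesis
        by (simp add: e(2) field_simps)
    qed
    have "norm x \<le> (\<Sum>i\<in>UNIV. \<bar>x $ i\<bar>)"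
      by (rule norm_le_l1_cart)
    also have "\<dots> \<le> (\<Sum>i\<in>(UNIV :: 'n set). 2 * real B)"
      by (intro sum_mono comp)
    finally show "x \<in> cball 0 (real CARD('n) * (2 * real B))"
      by simp
  qed
  then show ?thesis by (rule that)
qed

lemma compact_shape:
  assumes "bounded P"
  shows "compact (shape P)"
proof -
  obtain R where "\<And>k. grid_shape k P \<subseteq> cball 0 R"
    using grid_shape_bounded[OF assms] by blast
  then have "shape P \<subseteq> cball 0 R"
    by (intro shape_minimal) auto
  then show ?thesis
    using closed_shape bounded_subset[OF bounded_cball] by (auto simp: compact_eq_bounded_closed)
qed

section \<open>Volume of the limit shape\<close>

lemma grid_shape_in_range_grid_floor: "grid_shape k P \<subseteq> range (grid_floor k)"
proof
  fix x assume "x \<in> grid_shape k P"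
  then have "2 ^ k *\<^sub>R x \<in> integer_points"
    by (auto simp: grid_shape_def integer_points_def)
  then show "x \<in> range (grid_floor k)"
    by (rule scaled_integer_in_range_grid_floor)
qed

lemma card_grid_shape:
  assumes "bounded P"
  shows "card (grid_shape k P) = card (lattice_points (2 ^ k) P)"
proof -
  have "inj (\<lambda>e :: nat ^ 'n. (1 / 2 ^ k :: real) *\<^sub>R real_vec e)"
    using inj_real_vec by (auto simp: inj_on_def)
  then have "card (grid_shape k P) = card (std (lattice_points (2 ^ k) P))"
    unfolding grid_shape_def by (intro card_image) (auto intro: inj_on_subset)
  then show ?thesis
    using std_card[OF finite_lattice_points[OF assms]] by simp
qed

text \<open>An interior point is strictly dominated in every coordinate by some \<open>y\<close> of
  the chain. All later levels contain \<open>y\<close> and, by downward closure, the rounding of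
  \<open>x\<close>.\<close>

lemma grid_floor_in_grid_shape:
  assumes "convex P" "bounded P" "x \<in> interior (shape P)"
  shows "\<forall>\<^sub>F k in sequentially. grid_floor k x \<in> grid_shape k P"
proof -
  obtain \<epsilon> where \<epsilon>: "\<epsilon> > 0" "cball x \<epsilon> \<subseteq> shape P"
    using assms(3) mem_interior_cball by blast
  \<comment> \<open>Here \<open>1\<close> is the all-ones vector: shifting \<open>x\<close>
    diagonally by \<open>\<delta>\<close> moves it by exactly \<open>\<epsilon>\<close>, and points
    within \<open>\<delta>\<close> of the shifted one exceed \<open>x\<close> in every
    coordinate.\<close>
  define \<delta> where "\<delta> = \<epsilon> / norm (1 :: real ^ 'n)"
  have "norm (1 :: real ^ 'n) > 0"
    by (simp add: vec_eq_iff)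
  then have "\<delta> > 0" "norm (\<delta> *\<^sub>R (1 :: real ^ 'n)) = \<epsilon>"
    using \<epsilon>(1) by (simp_all add: \<delta>_def)
  then have "x + \<delta> *\<^sub>R 1 \<in> cball x \<epsilon>"
    by (simp add: dist_norm)
  then have "x + \<delta> *\<^sub>R 1 \<in> closure (\<Union>k. grid_shape k P)"
    using \<epsilon>(2) unfolding shape_eq by blast
  then obtain y where "y \<in> (\<Union>k. grid_shape k P)" and close: "dist y (x + \<delta> *\<^sub>R 1) < \<delta>"
    using closure_approachable \<open>\<delta> > 0\<close> by blast
  then obtain j where j: "y \<in> grid_shape j P" by blast
  have less: "x $ i < y $ i" for i
  proof -
    have "\<bar>(y - (x + \<delta> *\<^sub>R 1)) $ i\<bar> < \<delta>"
      using close component_le_norm_cart[of "y - (x + \<delta> *\<^sub>R 1)" i] by (simp only: dist_norm)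
    then show ?thesis by simp
  qed
  have "grid_floor k x \<in> grid_shape k P" if "k \<ge> j" for k
  proof -
    have "y \<in> grid_shape k P"
      using j grid_shape_mono[OF assms(1,2) \<open>k \<ge> j\<close>] by blast
    then obtain e where e: "e \<in> std (lattice_points (2 ^ k) P)" "y = (1 / 2 ^ k) *\<^sub>R real_vec e"
      by (auto simp: grid_shape_def)
    \<comment> \<open>The coordinates of \<open>x\<close> are nonnegative, so \<open>nat\<close>
      does not truncate.\<close>
    define f :: "nat ^ 'n" where "f = (\<chi> i. nat \<lfloor>2 ^ k * x $ i\<rfloor>)"
    have nonneg: "0 \<le> 2 ^ k * x $ i" for i
      using shape_nonneg[OF subsetD[OF interior_subset assms(3)]] by simp
    have "f $ i \<le> e $ i" for i
    proof -
      have "2 ^ k * x $ i < real (e $ i)"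
        using less[of i] by (simp add: e(2) field_simps)
      then show ?thesis
        unfolding f_def by (simp add: floor_le_iff nat_le_iff)
    qed
    then have "f \<in> std (lattice_points (2 ^ k) P)"
      by (rule std_lower[OF e(1)])
    moreover have "grid_floor k x = (1 / 2 ^ k) *\<^sub>R real_vec f"
      using nonneg by (simp add: f_def grid_floor_def vec_eq_iff)
    ultimately show ?thesis
      unfolding grid_shape_def by blast
  qed
  then show ?thesis
    unfolding eventually_sequentially by blast
qed

text \<open>On each level there are as many standard exponents as lattice points, so both volumes
  are limits of the same normalised counts.\<close>

lemma measure_shape:
  assumes "convex P" "bounded P"
  shows "measure lebesgue (shape P) = measure lebesgue P"
proof -
  obtain R where R: "\<And>k. grid_shape k P \<subseteq> cball 0 R"
    using grid_shape_bounded[OF assms(2)] by blast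
  have "(\<lambda>k. real (card (grid_shape k P)) / 2 ^ (k * CARD('n))) \<longlonglongrightarrow> measure lebesgue (shape P)"
  proof (rule grid_count_limit[OF _ _ grid_shape_in_range_grid_floor R])
    show "bounded (shape P)"
      using compact_shape[OF assms(2)] by (rule compact_imp_bounded)
    show "negligible (frontier (shape P))"
      by (intro negligible_convex_frontier convex_shape assms)
    fix x
    show "\<forall>\<^sub>F k in sequentially. grid_floor k x \<in> grid_shape k P" if "x \<in> interior (shape P)"
      using grid_floor_in_grid_shape[OF assms that] .
    show "\<forall>\<^sub>F k in sequentially. grid_floor k x \<notin> grid_shape k P" if "x \<notin> closure (shape P)"
    proof -
      have "x \<in> - shape P" "open (- shape P)"
        using that closed_shape closure_closed by auto
      from topological_tendstoD[OF grid_floor_tendsto this(2,1)] show ?thesis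
        by (rule eventually_mono) (use grid_shape_subset_shape in blast)
    qed
  qed
  then show ?thesis
    using lattice_count_limit[OF assms] LIMSEQ_unique
    unfolding card_grid_shape[OF assms(2)] by blast
qed

section \<open>Invariance of the limit shape under translations\<close>

text \<open>The shape is a convex body of the same volume as \<open>P\<close>, so a volume
  comparison upgrades the inclusion to an equality.\<close>

lemma shape_eq_if_subset:
  assumes "convex P" "bounded P" "measure lebesgue P > 0"
    and "closed T" "T \<subseteq> shape P" "measure lebesgue P \<le> measure lebesgue T"
  shows "T = shape P"
  using assms convex_shape compact_imp_bounded[OF compact_shape] measure_shape
  by (intro closed_subset_full_measure) auto

text \<open>The chain property allows passing to large levels, and translation invariance of
  standard exponents lets \<open>w\<close> vary with the level.\<close>

lemma shape_subset:
  assumes "convex Q" "bounded Q" "bounded P"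
    and ev: "\<forall>\<^sub>F j in sequentially. \<exists>w. lattice_points (2 ^ j) Q \<subseteq> (+) w ` lattice_points (2 ^ j) P"
  shows "shape Q \<subseteq> shape P"
proof (rule shape_minimal[OF _ closed_shape])
  fix k
  obtain J where J: "\<And>j. j \<ge> J \<Longrightarrow> \<exists>w. lattice_points (2 ^ j) Q \<subseteq> (+) w ` lattice_points (2 ^ j) P"
    using ev unfolding eventually_sequentially by blast
  define j where "j = max J k"
  obtain w where "lattice_points (2 ^ j) Q \<subseteq> (+) w ` lattice_points (2 ^ j) P"
    using J[of j] by (auto simp: j_def)
  then have "std (lattice_points (2 ^ j) Q) \<subseteq> std (lattice_points (2 ^ j) P)"
    using std_mono std_translate[OF finite_lattice_points[OF assms(3)]] by metis
  then have "grid_shape j Q \<subseteq> grid_shape j P"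
    unfolding grid_shape_def by blast
  moreover have "grid_shape k Q \<subseteq> grid_shape j Q"
    by (rule grid_shape_mono[OF assms(1,2)]) (simp add: j_def)
  ultimately show "grid_shape k Q \<subseteq> shape P"
    using grid_shape_subset_shape by blast
qed

text \<open>A slightly shrunken copy \<open>Q\<close> of \<open>P\<close> leaves room for rounding \<open>2\<^sup>j v\<close> to a lattice vector.\<close>

lemma shape_shrink_translate_subset:
  fixes v :: "real ^ 'n"
  assumes "convex P" "bounded P" "c \<in> interior P" "0 < t" "t < 1"
  shows "shape ((\<lambda>x. t *\<^sub>R x + ((1 - t) *\<^sub>R c + v)) ` P) \<subseteq> shape P"
proof (rule shape_subset)
  let ?Q = "(\<lambda>x. t *\<^sub>R x + ((1 - t) *\<^sub>R c + v)) ` P"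
  show "convex ?Q" "bounded ?Q"
    by (intro convex_affine_image bounded_affine_image assms)+
  show "bounded P" by fact
  obtain \<rho> where \<rho>: "\<rho> > 0" "ball c \<rho> \<subseteq> P"
    using assms(3) mem_interior by blast
  \<comment> \<open>The ball around \<open>c\<close>, scaled by \<open>1 - t\<close>, absorbs the
    error vector \<open>u\<close>.\<close>
  have room: "t *\<^sub>R x + (1 - t) *\<^sub>R c + u \<in> P" if "x \<in> P" "norm u < (1 - t) * \<rho>" for x u
  proof -
    have "norm ((1 / (1 - t)) *\<^sub>R u) < \<rho>"
      using that(2) assms(5) by (simp add: field_simps)
    then have "c + (1 / (1 - t)) *\<^sub>R u \<in> P"
      using \<rho>(2) by (auto simp: dist_norm)
    then have "t *\<^sub>R x + (1 - t) *\<^sub>R (c + (1 / (1 - t)) *\<^sub>R u) \<in> P"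
      using assms(4,5) that(1) by (intro convexD[OF assms(1)]) auto
    then show ?thesis
      using assms(5) by (simp add: scaleR_add_right add.assoc)
  qed
  have "\<forall>\<^sub>F j in sequentially. dist (grid_floor j v) v < (1 - t) * \<rho>"
    by (rule tendstoD[OF grid_floor_tendsto]) (use assms(5) \<rho>(1) in simp)
  then show "\<forall>\<^sub>F j in sequentially. \<exists>w. lattice_points (2 ^ j) ?Q \<subseteq> (+) w ` lattice_points (2 ^ j) P"
  proof eventually_elim
    case (elim j)
    define w where "w = 2 ^ j *\<^sub>R grid_floor j v"
    have "lattice_points (2 ^ j) ?Q \<subseteq> (+) w ` lattice_points (2 ^ j) P"
    proof
      fix a assume "a \<in> lattice_points (2 ^ j) ?Q"
      then obtain x where x: "x \<in> P" "a = 2 ^ j *\<^sub>R (t *\<^sub>R x + ((1 - t) *\<^sub>R c + v))" "a \<in> integer_points"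
        by (auto simp: lattice_points_def)
      have "norm (v - grid_floor j v) < (1 - t) * \<rho>"
        using elim by (simp add: dist_norm norm_minus_commute)
      then have "t *\<^sub>R x + (1 - t) *\<^sub>R c + (v - grid_floor j v) \<in> P"
        by (rule room[OF x(1)])
      moreover have "a - w = 2 ^ j *\<^sub>R (t *\<^sub>R x + (1 - t) *\<^sub>R c + (v - grid_floor j v))"
        by (simp add: x(2) w_def scaleR_add_right scaleR_diff_right add.assoc)
      moreover have "a - w \<in> integer_points"
        using x(3) scaled_grid_floor_integer[of j v] by (simp add: w_def integer_points_def)
      ultimately have "a - w \<in> lattice_points (2 ^ j) P"
        unfolding lattice_points_def by blast
      then show "a \<in> (+) w ` lattice_points (2 ^ j) P"
        by (intro image_eqI[of _ _ "a - w"]) auto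
    qed
    then show ?case by blast
  qed
qed

text \<open>The shape of a shrunken copy of \<open>P + v\<close> lies in both shapes. As the factor
  \<open>t\<close> tends to 1, the intersection of the two shapes is seen to have full volume, so it
  is the whole shape of \<open>P + v\<close>.\<close>

lemma shape_translate_subset:
  assumes "convex P" "bounded P" "measure lebesgue P > 0"
  shows "shape ((\<lambda>x. x + v) ` P) \<subseteq> shape P"
proof -
  let ?Q = "(\<lambda>x. x + v) ` P"
  have Q: "convex ?Q" "bounded ?Q" "measure lebesgue ?Q = measure lebesgue P"
    using convex_affine_image[OF assms(1), of 1 v] bounded_affine_image[OF assms(2), of 1 v]
    by (simp_all add: measure_shift)
  obtain c where c: "c \<in> interior P"
    using interior_nonempty_if_measure_pos[OF assms(1,3)] by blast
  then have cQ: "c + v \<in> interior ?Q"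
    using interior_translation[of v P] by (simp add: add.commute image_iff)
  define T where "T = shape ?Q \<inter> shape P"
  have T: "closed T" "T \<in> lmeasurable"
  proof -
    show "closed T" unfolding T_def by (intro closed_Int closed_shape)
    have "compact T" unfolding T_def by (intro compact_Int compact_shape assms Q)
    then show "T \<in> lmeasurable" by (rule lmeasurable_compact)
  qed
  have shrunk: "t ^ CARD('n) * measure lebesgue P \<le> measure lebesgue T" if t: "0 < t" "t < 1" for t
  proof -
    let ?R = "(\<lambda>x. t *\<^sub>R x + ((1 - t) *\<^sub>R c + v)) ` P"
    have "convex ?R" "bounded ?R"
      by (intro convex_affine_image bounded_affine_image assms)+
    then have "measure lebesgue (shape ?R) = t ^ CARD('n) * measure lebesgue P" "shape ?R \<in> lmeasurable"
      using measure_shape[of ?R] measure_affine[of t _ P] t compact_shape lmeasurable_compact by auto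
    moreover have "shape ?R \<subseteq> T"
    proof -
      \<comment> \<open>The same copy, viewed as \<open>P + v\<close> shrunk towards
        \<open>c + v\<close> with no further translation.\<close>
      have "?R = (\<lambda>x. t *\<^sub>R x + ((1 - t) *\<^sub>R (c + v) + 0)) ` ?Q"
        by (simp add: image_image algebra_simps)
      then have "shape ?R \<subseteq> shape ?Q"
        using shape_shrink_translate_subset[OF Q(1,2) cQ t, of 0] by simp
      then show ?thesis
        using shape_shrink_translate_subset[OF assms(1,2) c t] by (simp add: T_def)
    qed
    ultimately show ?thesis
      using measure_mono_fmeasurable[of "shape ?R" T lebesgue] T(2) by auto
  qed
  have "((\<lambda>t. t ^ CARD('n) * measure lebesgue P) \<longlongrightarrow> 1 ^ CARD('n) * measure lebesgue P) (at_left (1::real))"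
    by (intro tendsto_intros)
  moreover have "\<forall>\<^sub>F t in at_left (1::real). t ^ CARD('n) * measure lebesgue P \<le> measure lebesgue T"
    by (rule eventually_mono[OF eventually_at_left_real[of 0 1]]) (auto intro: shrunk)
  ultimately have "1 ^ CARD('n) * measure lebesgue P \<le> measure lebesgue T"
    by (rule tendsto_upperbound) simp
  then have "measure lebesgue P \<le> measure lebesgue T" by simp
  then have "T = shape ?Q"
    using Q assms(3) T(1) by (intro shape_eq_if_subset) (auto simp: T_def)
  then show ?thesis by (auto simp: T_def)
qed

lemma shape_translate:
  assumes "convex P" "bounded P" "measure lebesgue P > 0"
  shows "shape ((\<lambda>x. x + v) ` P) = shape P"
proof
  show "shape ((\<lambda>x. x + v) ` P) \<subseteq> shape P"
    by (rule shape_translate_subset[OF assms])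
  let ?Q = "(\<lambda>x. x + v) ` P"
  have "convex ?Q" "bounded ?Q"
    using convex_affine_image[OF assms(1), of 1 v] bounded_affine_image[OF assms(2), of 1 v]
    by simp_all
  moreover have "measure lebesgue ?Q > 0"
    using assms(3) by (simp add: measure_shift)
  ultimately have "shape ((\<lambda>x. x + - v) ` ?Q) \<subseteq> shape ?Q"
    by (rule shape_translate_subset)
  then show "shape P \<subseteq> shape ?Q"
    by (simp add: image_image)
qed

section \<open>Scaling of the limit shape\<close>

text \<open>A convex set containing the origin is star-shaped about it, so its dilates grow with the
  factor.\<close>

lemma lattice_points_mono:
  assumes "convex P" "0 \<in> P" "0 \<le> s" "s \<le> t"
  shows "lattice_points s P \<subseteq> lattice_points t P"
proof
  fix a assume a: "a \<in> lattice_points s P"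
  then obtain x where x: "x \<in> P" "a = s *\<^sub>R x"
    by (auto simp: lattice_points_def)
  show "a \<in> lattice_points t P"
  proof (cases "t = 0")
    case True
    then show ?thesis using a assms by simp
  next
    case False
    then have "(s / t) *\<^sub>R x \<in> P"
      using convexD[OF assms(1) x(1) assms(2), of "s / t" "1 - s / t"] assms(3,4) by simp
    moreover have "a = t *\<^sub>R ((s / t) *\<^sub>R x)"
      using x(2) False by simp
    ultimately show ?thesis
      using a unfolding lattice_points_def by blast
  qed
qed

text \<open>With \<open>m\<close> the floor of \<open>2 ^ j * d\<close>, the \<open>m\<close>-fold
  of an exponent of level \<open>k\<close> is standard for \<open>m * 2 ^ k * P\<close>, which lies
  in \<open>2 ^ (j + k) * d * P\<close> as \<open>0 \<in> P\<close>. Since \<open>m / 2 ^ j\<close>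
  tends to \<open>d\<close>, this gives one inclusion, and volumes give equality.\<close>

lemma shape_scale_if_zero_mem:
  assumes "convex P" "bounded P" "measure lebesgue P > 0" "0 \<in> P" "d > 0"
  shows "shape ((\<lambda>x. d *\<^sub>R x) ` P) = (\<lambda>x. d *\<^sub>R x) ` shape P"
proof -
  let ?Q = "(\<lambda>x. d *\<^sub>R x) ` P"
  have lat: "lattice_points s ?Q = lattice_points (s * d) P" for s
    by (simp add: lattice_points_def image_image)
  have grid: "d *\<^sub>R x \<in> shape ?Q" if x: "x \<in> grid_shape k P" for x k
  proof -
    have "(of_int \<lfloor>2 ^ j * d\<rfloor> / 2 ^ j) *\<^sub>R x \<in> shape ?Q" if pos: "of_int \<lfloor>2 ^ j * d\<rfloor> / 2 ^ j > (0::real)" for j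
    proof -
      define m where "m = nat \<lfloor>2 ^ j * d\<rfloor>"
      have m: "m > 0" "real m = of_int \<lfloor>2 ^ j * d\<rfloor>"
        using pos by (auto simp: m_def zero_less_divide_iff)
      obtain e where e: "e \<in> std (lattice_points (real m * 2 ^ k) P)" "real_vec e = (real m * 2 ^ k) *\<^sub>R x"
        using grid_shape_multiple[OF assms(1,2) x m(1)] by blast
      have "real m \<le> 2 ^ j * d"
        unfolding m by linarith
      then have "real m * 2 ^ k \<le> 2 ^ (j + k) * d"
        by (simp add: power_add mult_ac)
      then have "std (lattice_points (real m * 2 ^ k) P) \<subseteq> std (lattice_points (2 ^ (j + k)) ?Q)"
        unfolding lat by (intro std_mono lattice_points_mono assms) auto
      then have "(1 / 2 ^ (j + k)) *\<^sub>R real_vec e \<in> grid_shape (j + k) ?Q"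
        using e(1) unfolding grid_shape_def by blast
      moreover have "(1 / 2 ^ (j + k)) *\<^sub>R real_vec e = (of_int \<lfloor>2 ^ j * d\<rfloor> / 2 ^ j) *\<^sub>R x"
        by (simp add: e(2) m(2)[symmetric] power_add)
      ultimately show ?thesis
        using grid_shape_subset_shape by fastforce
    qed
    \<comment> \<open>The dyadic approximations tend to \<open>d > 0\<close>, so they are eventually
      positive.\<close>
    then have "\<forall>\<^sub>F j in sequentially. (of_int \<lfloor>2 ^ j * d\<rfloor> / 2 ^ j) *\<^sub>R x \<in> shape ?Q"
      using order_tendstoD(1)[OF dyadic_floor_tendsto assms(5)] by (auto elim: eventually_mono)
    moreover have "(\<lambda>j. (of_int \<lfloor>2 ^ j * d\<rfloor> / 2 ^ j) *\<^sub>R x) \<longlonglongrightarrow> d *\<^sub>R x"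
      by (intro tendsto_scaleR dyadic_floor_tendsto tendsto_const)
    ultimately show ?thesis
      using Lim_in_closed_set[OF closed_shape] by force
  qed
  have Q: "convex ?Q" "bounded ?Q"
    using assms(1,2) by (auto intro: convex_scaling bounded_scaling)
  have "shape P \<subseteq> (\<lambda>x. (1 / d) *\<^sub>R x) ` shape ?Q"
  proof (rule shape_minimal)
    show "closed ((\<lambda>x. (1 / d) *\<^sub>R x) ` shape ?Q)"
      by (intro closed_scaling closed_shape)
    show "grid_shape k P \<subseteq> (\<lambda>x. (1 / d) *\<^sub>R x) ` shape ?Q" for k
    proof
      fix x assume "x \<in> grid_shape k P"
      then show "x \<in> (\<lambda>x. (1 / d) *\<^sub>R x) ` shape ?Q"
        using assms(5) by (intro image_eqI[OF _ grid]) auto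
    qed
  qed
  then have "(\<lambda>x. d *\<^sub>R x) ` shape P \<subseteq> (\<lambda>x. d *\<^sub>R x) ` (\<lambda>x. (1 / d) *\<^sub>R x) ` shape ?Q"
    by (rule image_mono)
  then have "(\<lambda>x. d *\<^sub>R x) ` shape P \<subseteq> shape ?Q"
    using assms(5) by (simp add: image_image)
  then have "(\<lambda>x. d *\<^sub>R x) ` shape P = shape ?Q"
    using Q assms closed_shape measure_shape[OF assms(1,2)]
    by (intro shape_eq_if_subset) (auto simp: measure_scale intro: closed_scaling)
  then show ?thesis ..
qed

text \<open>Moving a point \<open>c\<close> of \<open>P\<close> to the origin reduces to the
  previous case; the shift by \<open>d *\<^sub>R c\<close> after scaling matches the shift by
  \<open>c\<close> before it.\<close>

lemma shape_scale:
  assumes "convex P" "bounded P" "measure lebesgue P > 0" "d > 0"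
  shows "shape ((\<lambda>x. d *\<^sub>R x) ` P) = (\<lambda>x. d *\<^sub>R x) ` shape P"
proof -
  obtain c where c: "c \<in> P"
    using interior_nonempty_if_measure_pos[OF assms(1,3)] interior_subset by blast
  let ?P = "(\<lambda>x. x + - c) ` P"
  have P: "convex ?P" "bounded ?P"
    using convex_affine_image[OF assms(1), of 1 "- c"] bounded_affine_image[OF assms(2), of 1 "- c"]
    by simp_all
  have dP: "convex ((\<lambda>x. d *\<^sub>R x) ` P)" "bounded ((\<lambda>x. d *\<^sub>R x) ` P)"
    "measure lebesgue ((\<lambda>x. d *\<^sub>R x) ` P) > 0"
    using assms by (auto intro: convex_scaling bounded_scaling simp: measure_scale)
  have "shape ((\<lambda>x. d *\<^sub>R x) ` P) = shape ((\<lambda>x. x + - (d *\<^sub>R c)) ` (\<lambda>x. d *\<^sub>R x) ` P)"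
    by (rule shape_translate[OF dP, symmetric])
  also have "(\<lambda>x. x + - (d *\<^sub>R c)) ` (\<lambda>x. d *\<^sub>R x) ` P = (\<lambda>x. d *\<^sub>R x) ` ?P"
    by (simp add: image_image scaleR_diff_right)
  also have "shape ((\<lambda>x. d *\<^sub>R x) ` ?P) = (\<lambda>x. d *\<^sub>R x) ` shape ?P"
  proof (rule shape_scale_if_zero_mem[OF P _ _ assms(4)])
    show "measure lebesgue ?P > 0" using assms(3) by (simp only: measure_shift)
    show "0 \<in> ?P" using c by (auto simp: image_iff)
  qed
  also have "shape ?P = shape P"
    by (rule shape_translate[OF assms(1-3)])
  finally show ?thesis .
qed

end

theorem theorem8:
  fixes r :: "((nat ^ 'n) \<times> (nat ^ 'n)) set"
    and P :: "(real ^ 'n::finite) set"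
  assumes "monomial_order r"
    and "bounded P"
    and "convex P"
    and "measure lebesgue P > 0"
  shows "convex (limit_shape r P)
    \<and> compact (limit_shape r P)
    \<and> measure lebesgue (limit_shape r P) = measure lebesgue P
    \<and> (\<forall>d::real. d > 0 \<longrightarrow>
          limit_shape r ((\<lambda>x. d *\<^sub>R x) ` P) = (\<lambda>x. d *\<^sub>R x) ` limit_shape r P)
    \<and> (\<forall>v::real ^ 'n. limit_shape r ((\<lambda>x. x + v) ` P) = limit_shape r P)"
proof -
  interpret monomial_ordering r
    by unfold_locales (rule assms(1))
  show ?thesis
    using convex_shape compact_shape measure_shape shape_scale shape_translate assms(2-4)
    by simp
qed

end
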